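(* The following conditions on a poset $\mathcal{A}$ (viewed as a category) are equivalent: (1) $\mathbf{Set}^{\mathcal{A}^{\mathrm{op}}}$ is a DCC category; (2) $\mathbf{Set}^{\mathcal{A}^{\mathrm{op}}}$ is graduated; (3) every subset of $\mathcal{A}$ with an upper bound in $\mathcal{A}$ is finite.
   Context: A poset is viewed as a category with a unique morphism $b\to a$ whenever $b\le a$. An object is finitely presentable if its covariant hom-functor preserves directed colimits. A locally finitely presentable category is graduated if every finitely presentable object $X$ carries a grade, a natural number, such that all subobjects and all strong quotients of $X$ are also finitely presentable and have grades lower than or equal to that of $X$, and all proper subobjects and all proper strong quotients of $X$ have grades strictly lower than that of $X$. A locally finitely presentable category is a DCC category if for every finitely presentable object $A$: (a) every subobject of $A$ is finitely presentable, and all (strictly) descending chains of subobjects of $A$ are finite; (b) every strong quotient of $A$ is finitely presentable, and all (strictly) descending chains of strong quotients of $A$ are finite. Quotients are ordered by: $e\le e'$ for $e\colon A\twoheadrightarrow Q$, $e'\colon A\twoheadrightarrow Q'$ iff $e'=h\cdot e$ for some $h\colon Q\to Q'$. In presheaf categories all quotients (epimorphisms) are strong. *)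

theory Defs
  imports "HOL-Library.FuncSet" "HOL-Library.Equipollence"
begin

section \<open>Categories, functors, natural transformations\<close>

record ('o, 'm) cat =
  Obj :: "'o set"
  Arr :: "'m set"
  Dom :: "'m \<Rightarrow> 'o"
  Cod :: "'m \<Rightarrow> 'o"
  Ident :: "'o \<Rightarrow> 'm"
  Comp :: "'m \<Rightarrow> 'm \<Rightarrow> 'm"  \<comment> \<open>\<open>Comp C g f\<close> is \<open>f\<close> followed by \<open>g\<close>\<close>

definition hom :: "('o, 'm) cat \<Rightarrow> 'o \<Rightarrow> 'o \<Rightarrow> 'm set" where
  "hom C X Y = {f \<in> Arr C. Dom C f = X \<and> Cod C f = Y}"

definition category :: "('o, 'm) cat \<Rightarrow> bool" where
  "category C \<longleftrightarrow>
     (\<forall>f \<in> Arr C. Dom C f \<in> Obj C \<and> Cod C f \<in> Obj C) \<and>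
     (\<forall>X \<in> Obj C. Ident C X \<in> hom C X X) \<and>
     (\<forall>f \<in> Arr C. \<forall>g \<in> Arr C. Cod C f = Dom C g \<longrightarrow> Comp C g f \<in> hom C (Dom C f) (Cod C g)) \<and>
     (\<forall>f \<in> Arr C. Comp C f (Ident C (Dom C f)) = f \<and> Comp C (Ident C (Cod C f)) f = f) \<and>
     (\<forall>f \<in> Arr C. \<forall>g \<in> Arr C. \<forall>h \<in> Arr C. Cod C f = Dom C g \<longrightarrow> Cod C g = Dom C h \<longrightarrow>
        Comp C h (Comp C g f) = Comp C (Comp C h g) f)"

definition op_cat :: "('o, 'm) cat \<Rightarrow> ('o, 'm) cat" where
  "op_cat C = \<lparr>Obj = Obj C, Arr = Arr C, Dom = Cod C, Cod = Dom C,
     Ident = Ident C, Comp = (\<lambda>g f. Comp C f g)\<rparr>"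

text \<open>A relation \<open>r\<close> as a category: \<open>(b, a) \<in> r\<close>, that is \<open>b \<le> a\<close>, is itself the unique
  arrow from \<open>b\<close> to \<open>a\<close>.\<close>

definition poset_cat :: "'a set \<Rightarrow> 'a rel \<Rightarrow> ('a, 'a \<times> 'a) cat" where
  "poset_cat A r = \<lparr>Obj = A, Arr = r, Dom = fst, Cod = snd,
     Ident = (\<lambda>a. (a, a)), Comp = (\<lambda>g f. (fst f, snd g))\<rparr>"

text \<open>All maps in this theory are taken to be extensional (equal to \<^const>\<open>undefined\<close> outside
  their domain), so that equality of arrows and of functors has its usual meaning.\<close>

definition set_cat :: "'u set set \<Rightarrow> ('u set, 'u set \<times> ('u \<Rightarrow> 'u) \<times> 'u set) cat" where
  "set_cat U = \<lparr>Obj = U,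
     Arr = {(X, f, Y). X \<in> U \<and> Y \<in> U \<and> f \<in> X \<rightarrow>\<^sub>E Y},
     Dom = (\<lambda>(X, f, Y). X),
     Cod = (\<lambda>(X, f, Y). Y),
     Ident = (\<lambda>X. (X, \<lambda>x\<in>X. x, X)),
     Comp = (\<lambda>(_, g, Z) (X, f, _). (X, compose X g f, Z))\<rparr>"

record ('o, 'm, 'p, 'n) ftor =
  Fo :: "'o \<Rightarrow> 'p"
  Fm :: "'m \<Rightarrow> 'n"

definition is_functor :: "('o, 'm) cat \<Rightarrow> ('p, 'n) cat \<Rightarrow> ('o, 'm, 'p, 'n) ftor \<Rightarrow> bool" where
  "is_functor C D F \<longleftrightarrow>
     Fo F \<in> Obj C \<rightarrow>\<^sub>E Obj D \<and>
     Fm F \<in> extensional (Arr C) \<and>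
     (\<forall>f \<in> Arr C. Fm F f \<in> hom D (Fo F (Dom C f)) (Fo F (Cod C f))) \<and>
     (\<forall>X \<in> Obj C. Fm F (Ident C X) = Ident D (Fo F X)) \<and>
     (\<forall>f \<in> Arr C. \<forall>g \<in> Arr C. Cod C f = Dom C g \<longrightarrow>
        Fm F (Comp C g f) = Comp D (Fm F g) (Fm F f))"

definition comp_ftor ::
    "('o, 'm) cat \<Rightarrow> ('p, 'n, 'q, 'l) ftor \<Rightarrow> ('o, 'm, 'p, 'n) ftor \<Rightarrow> ('o, 'm, 'q, 'l) ftor" where
  "comp_ftor C G F = \<lparr>Fo = (\<lambda>X \<in> Obj C. Fo G (Fo F X)), Fm = (\<lambda>f \<in> Arr C. Fm G (Fm F f))\<rparr>"

definition nat_trans :: "('o, 'm) cat \<Rightarrow> ('p, 'n) cat \<Rightarrow>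
    ('o, 'm, 'p, 'n) ftor \<Rightarrow> ('o, 'm, 'p, 'n) ftor \<Rightarrow> ('o \<Rightarrow> 'n) \<Rightarrow> bool" where
  "nat_trans C D F G t \<longleftrightarrow>
     is_functor C D F \<and> is_functor C D G \<and>
     t \<in> extensional (Obj C) \<and>
     (\<forall>X \<in> Obj C. t X \<in> hom D (Fo F X) (Fo G X)) \<and>
     (\<forall>f \<in> Arr C. Comp D (t (Cod C f)) (Fm F f) = Comp D (Fm G f) (t (Dom C f)))"

definition functor_cat :: "('o, 'm) cat \<Rightarrow> ('p, 'n) cat \<Rightarrow>
    (('o, 'm, 'p, 'n) ftor,
     ('o, 'm, 'p, 'n) ftor \<times> ('o \<Rightarrow> 'n) \<times> ('o, 'm, 'p, 'n) ftor) cat" where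
  "functor_cat C D = \<lparr>Obj = {F. is_functor C D F},
     Arr = {(F, t, G). nat_trans C D F G t},
     Dom = (\<lambda>(F, t, G). F),
     Cod = (\<lambda>(F, t, G). G),
     Ident = (\<lambda>F. (F, \<lambda>X \<in> Obj C. Ident D (Fo F X), F)),
     Comp = (\<lambda>(_, s, H) (F, t, _). (F, \<lambda>X \<in> Obj C. Comp D (s X) (t X), H))\<rparr>"


section \<open>Special arrows, subobjects and strong quotients\<close>

definition iso_arr :: "('o, 'm) cat \<Rightarrow> 'm \<Rightarrow> bool" where
  "iso_arr C f \<longleftrightarrow> f \<in> Arr C \<and>
     (\<exists>g \<in> hom C (Cod C f) (Dom C f).
        Comp C g f = Ident C (Dom C f) \<and> Comp C f g = Ident C (Cod C f))"

definition mono_arr :: "('o, 'm) cat \<Rightarrow> 'm \<Rightarrow> bool" where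
  "mono_arr C m \<longleftrightarrow> m \<in> Arr C \<and>
     (\<forall>W \<in> Obj C. \<forall>g \<in> hom C W (Dom C m). \<forall>h \<in> hom C W (Dom C m).
        Comp C m g = Comp C m h \<longrightarrow> g = h)"

definition epi_arr :: "('o, 'm) cat \<Rightarrow> 'm \<Rightarrow> bool" where
  "epi_arr C e \<longleftrightarrow> e \<in> Arr C \<and>
     (\<forall>W \<in> Obj C. \<forall>g \<in> hom C (Cod C e) W. \<forall>h \<in> hom C (Cod C e) W.
        Comp C g e = Comp C h e \<longrightarrow> g = h)"

text \<open>Strong epimorphisms: epimorphisms with the diagonal fill-in property against all
  monomorphisms.\<close>

definition strong_epi_arr :: "('o, 'm) cat \<Rightarrow> 'm \<Rightarrow> bool" where
  "strong_epi_arr C e \<longleftrightarrow> epi_arr C e \<and>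
     (\<forall>m u v. mono_arr C m \<longrightarrow> u \<in> hom C (Dom C e) (Dom C m) \<longrightarrow>
        v \<in> hom C (Cod C e) (Cod C m) \<longrightarrow> Comp C m u = Comp C v e \<longrightarrow>
        (\<exists>d \<in> hom C (Cod C e) (Dom C m). Comp C d e = u \<and> Comp C m d = v))"

text \<open>Subobjects and strong quotients are given by representing arrows. The relations
  \<open>sub_le\<close> and \<open>quot_le\<close> are preorders on representatives; their strict parts below are
  exactly the strict orders between the represented equivalence classes.\<close>

definition subobjects :: "('o, 'm) cat \<Rightarrow> 'o \<Rightarrow> 'm set" where
  "subobjects C X = {m. mono_arr C m \<and> Cod C m = X}"

definition strong_quotients :: "('o, 'm) cat \<Rightarrow> 'o \<Rightarrow> 'm set" where
  "strong_quotients C X = {e. strong_epi_arr C e \<and> Dom C e = X}"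

definition sub_le :: "('o, 'm) cat \<Rightarrow> 'm \<Rightarrow> 'm \<Rightarrow> bool" where
  "sub_le C m m' \<longleftrightarrow> (\<exists>h \<in> hom C (Dom C m) (Dom C m'). m = Comp C m' h)"

definition quot_le :: "('o, 'm) cat \<Rightarrow> 'm \<Rightarrow> 'm \<Rightarrow> bool" where
  "quot_le C e e' \<longleftrightarrow> (\<exists>h \<in> hom C (Cod C e) (Cod C e'). e' = Comp C h e)"

definition descending_chains_finite :: "('m \<Rightarrow> 'm \<Rightarrow> bool) \<Rightarrow> 'm set \<Rightarrow> bool" where
  "descending_chains_finite le S \<longleftrightarrow>
     \<not> (\<exists>s :: nat \<Rightarrow> 'm. (\<forall>n. s n \<in> S) \<and> (\<forall>n. le (s (Suc n)) (s n) \<and> \<not> le (s n) (s (Suc n))))"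


section \<open>Colimits\<close>

definition cocone :: "('j, 'k) cat \<Rightarrow> ('o, 'm) cat \<Rightarrow> ('j, 'k, 'o, 'm) ftor \<Rightarrow>
    'o \<Rightarrow> ('j \<Rightarrow> 'm) \<Rightarrow> bool" where
  "cocone J C D V c \<longleftrightarrow> V \<in> Obj C \<and>
     (\<forall>j \<in> Obj J. c j \<in> hom C (Fo D j) V) \<and>
     (\<forall>f \<in> Arr J. Comp C (c (Cod J f)) (Fm D f) = c (Dom J f))"

definition is_colimit :: "('j, 'k) cat \<Rightarrow> ('o, 'm) cat \<Rightarrow> ('j, 'k, 'o, 'm) ftor \<Rightarrow>
    'o \<Rightarrow> ('j \<Rightarrow> 'm) \<Rightarrow> bool" where
  "is_colimit J C D V c \<longleftrightarrow> cocone J C D V c \<and>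
     (\<forall>V' c'. cocone J C D V' c' \<longrightarrow>
        (\<exists>!h. h \<in> hom C V V' \<and> (\<forall>j \<in> Obj J. Comp C h (c j) = c' j)))"

definition directed_poset :: "'i set \<Rightarrow> 'i rel \<Rightarrow> bool" where
  "directed_poset I le \<longleftrightarrow> partial_order_on I le \<and> I \<noteq> {} \<and>
     (\<forall>i \<in> I. \<forall>j \<in> I. \<exists>k \<in> I. (i, k) \<in> le \<and> (j, k) \<in> le)"

text \<open>The hom-sets of a category are sets of arrows, so the covariant hom-functor is valued in
  the category of all sets of arrows.\<close>

definition hom_functor :: "('o, 'm) cat \<Rightarrow> 'o \<Rightarrow>
    ('o, 'm, 'm set, 'm set \<times> ('m \<Rightarrow> 'm) \<times> 'm set) ftor" where
  "hom_functor C X = \<lparr>Fo = (\<lambda>Y \<in> Obj C. hom C X Y),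
     Fm = (\<lambda>g \<in> Arr C. (hom C X (Dom C g), \<lambda>f \<in> hom C X (Dom C g). Comp C g f, hom C X (Cod C g)))\<rparr>"


section \<open>Size\<close>

text \<open>HOL has no type of all sets, so \<open>Set\<close> is the category of the members of a universe
  \<open>U\<close> of sets over some type: \<open>U\<close> contains an infinite set and is closed under passing to
  sets of at most the same cardinality and under unions of families indexed by a member of
  \<open>U\<close>. Equivalently, \<open>U\<close> consists of the sets of cardinality less than some regular
  uncountable cardinal. Closure under power sets is not demanded; if it holds, \<open>U\<close> is
  (up to bijection) a Grothendieck universe.\<close>

definition universe :: "'u set set \<Rightarrow> bool" where
  "universe U \<longleftrightarrow>
     (\<exists>X \<in> U. infinite X) \<and>
     (\<forall>X \<in> U. \<forall>Y. Y \<lesssim> X \<longrightarrow> Y \<in> U) \<and>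
     (\<forall>X \<in> U. \<forall>F :: 'u \<Rightarrow> 'u set. (\<forall>x \<in> X. F x \<in> U) \<longrightarrow> (\<Union>x \<in> X. F x) \<in> U)"

lemma universe_UNIV: "infinite (UNIV :: 'u set) \<Longrightarrow> universe (UNIV :: 'u set set)"
  by (auto simp: universe_def)

definition small :: "'u set set \<Rightarrow> 'b set \<Rightarrow> bool" where
  "small U B \<longleftrightarrow> (\<exists>K \<in> U. B \<lesssim> K)"


section \<open>Locally finitely presentable categories\<close>

text \<open>Every small category is isomorphic to one whose objects and arrows are elements of the
  type underlying \<open>U\<close>, so it suffices to consider diagrams of such shapes.\<close>

definition cocomplete :: "'u set set \<Rightarrow> ('o, 'm) cat \<Rightarrow> bool" where
  "cocomplete U C \<longleftrightarrow>
     (\<forall>(J :: ('u, 'u) cat) D. category J \<longrightarrow> Obj J \<in> U \<longrightarrow> Arr J \<in> U \<longrightarrow> is_functor J C D \<longrightarrow>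
        (\<exists>V c. is_colimit J C D V c))"

definition finitely_presentable :: "'u set set \<Rightarrow> ('o, 'm) cat \<Rightarrow> 'o \<Rightarrow> bool" where
  "finitely_presentable U C X \<longleftrightarrow> X \<in> Obj C \<and>
     (\<forall>(I :: 'u set) le D V c.
        I \<in> U \<longrightarrow> directed_poset I le \<longrightarrow> is_functor (poset_cat I le) C D \<longrightarrow>
        is_colimit (poset_cat I le) C D V c \<longrightarrow>
        is_colimit (poset_cat I le) (set_cat UNIV)
          (comp_ftor (poset_cat I le) (hom_functor C X) D)
          (Fo (hom_functor C X) V) (\<lambda>i. Fm (hom_functor C X) (c i)))"

definition locally_finitely_presentable :: "'u set set \<Rightarrow> ('o, 'm) cat \<Rightarrow> bool" where
  "locally_finitely_presentable U C \<longleftrightarrow> category C \<and> cocomplete U C \<and>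
     (\<exists>S. small U S \<and> (\<forall>X \<in> S. finitely_presentable U C X) \<and>
        (\<forall>X \<in> Obj C. \<exists>(I :: 'u set) le D c.
           I \<in> U \<and> directed_poset I le \<and> is_functor (poset_cat I le) C D \<and>
           (\<forall>i \<in> I. Fo D i \<in> S) \<and> is_colimit (poset_cat I le) C D X c))"

definition graduated_category :: "'u set set \<Rightarrow> ('o, 'm) cat \<Rightarrow> bool" where
  "graduated_category U C \<longleftrightarrow> locally_finitely_presentable U C \<and>
     (\<exists>grade :: 'o \<Rightarrow> nat. \<forall>X. finitely_presentable U C X \<longrightarrow>
        (\<forall>m \<in> subobjects C X. finitely_presentable U C (Dom C m) \<and>
           grade (Dom C m) \<le> grade X \<and>
           (\<not> iso_arr C m \<longrightarrow> grade (Dom C m) < grade X)) \<and>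
        (\<forall>e \<in> strong_quotients C X. finitely_presentable U C (Cod C e) \<and>
           grade (Cod C e) \<le> grade X \<and>
           (\<not> iso_arr C e \<longrightarrow> grade (Cod C e) < grade X)))"

definition DCC_category :: "'u set set \<Rightarrow> ('o, 'm) cat \<Rightarrow> bool" where
  "DCC_category U C \<longleftrightarrow> locally_finitely_presentable U C \<and>
     (\<forall>X. finitely_presentable U C X \<longrightarrow>
        (\<forall>m \<in> subobjects C X. finitely_presentable U C (Dom C m)) \<and>
        descending_chains_finite (sub_le C) (subobjects C X) \<and>
        (\<forall>e \<in> strong_quotients C X. finitely_presentable U C (Cod C e)) \<and>
        descending_chains_finite (quot_le C) (strong_quotients C X))"

abbreviation presheaf_cat where
  "presheaf_cat U A r \<equiv> functor_cat (op_cat (poset_cat A r)) (set_cat U)"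


section \<open>The constructions above are categories\<close>

lemma category_op_cat: "category C \<Longrightarrow> category (op_cat C)"
  by (auto simp: category_def op_cat_def hom_def)

lemma category_poset_cat: "partial_order_on A r \<Longrightarrow> category (poset_cat A r)"
  by (auto simp: category_def poset_cat_def hom_def partial_order_on_def preorder_on_def
      refl_on_def trans_def)

lemma category_set_cat: "category (set_cat U)"
  by (auto simp: category_def set_cat_def hom_def compose_def PiE_iff extensional_def
      restrict_def fun_eq_iff)

lemma category_functor_cat:
  assumes C: "category C" and D: "category D"
  shows "category (functor_cat C D)"
proof -
  note simps = functor_cat_def hom_def
  have dom_cod: "X \<in> Obj C" "Y \<in> Obj C" if "f \<in> Arr C" "Dom C f = X" "Cod C f = Y" for f X Y
    using C that by (auto simp: category_def)
  have compD: "Comp D g f \<in> Arr D" "Dom D (Comp D g f) = Dom D f" "Cod D (Comp D g f) = Cod D g"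
    if "f \<in> Arr D" "g \<in> Arr D" "Cod D f = Dom D g" for f g
    using D that by (auto simp: category_def hom_def)
  have assocD: "Comp D h (Comp D g f) = Comp D (Comp D h g) f"
    if "f \<in> Arr D" "g \<in> Arr D" "h \<in> Arr D" "Cod D f = Dom D g" "Cod D g = Dom D h" for f g h
    using D that by (auto simp: category_def)
  have idD: "Comp D f (Ident D (Dom D f)) = f" "Comp D (Ident D (Cod D f)) f = f"
    if "f \<in> Arr D" for f
    using D that by (auto simp: category_def)
  have identD: "Ident D X \<in> hom D X X" if "X \<in> Obj D" for X
    using D that by (auto simp: category_def)
  have ident: "nat_trans C D F F (\<lambda>X \<in> Obj C. Ident D (Fo F X))" if F: "is_functor C D F" for F
  proof -
    have "Ident D (Fo F X) \<in> hom D (Fo F X) (Fo F X)" if "X \<in> Obj C" for X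
      using F that by (intro identD) (auto simp: is_functor_def)
    moreover have "Comp D (Ident D (Fo F (Cod C f))) (Fm F f)
        = Comp D (Fm F f) (Ident D (Fo F (Dom C f)))" if "f \<in> Arr C" for f
      using F that idD[of "Fm F f"] by (auto simp: is_functor_def hom_def)
    ultimately show ?thesis
      using F dom_cod by (auto simp: nat_trans_def)
  qed
  have comp: "nat_trans C D F H (\<lambda>X \<in> Obj C. Comp D (s X) (t X))"
    if t: "nat_trans C D F G t" and s: "nat_trans C D G H s" for F G H t s
  proof -
    have tX: "t X \<in> Arr D" "Dom D (t X) = Fo F X" "Cod D (t X) = Fo G X"
      "s X \<in> Arr D" "Dom D (s X) = Fo G X" "Cod D (s X) = Fo H X" if "X \<in> Obj C" for X
      using t s that by (auto simp: nat_trans_def hom_def)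
    have "Comp D (Comp D (s (Cod C f)) (t (Cod C f))) (Fm F f)
        = Comp D (Fm H f) (Comp D (s (Dom C f)) (t (Dom C f)))" if f: "f \<in> Arr C" for f
    proof -
      have ob: "Dom C f \<in> Obj C" "Cod C f \<in> Obj C"
        using dom_cod f by auto
      have Ff: "Fm K f \<in> Arr D" "Dom D (Fm K f) = Fo K (Dom C f)" "Cod D (Fm K f) = Fo K (Cod C f)"
        if "K \<in> {F, G, H}" for K
        using t s f that by (auto simp: nat_trans_def is_functor_def hom_def)
      have nt: "Comp D (t (Cod C f)) (Fm F f) = Comp D (Fm G f) (t (Dom C f))"
        "Comp D (s (Cod C f)) (Fm G f) = Comp D (Fm H f) (s (Dom C f))"
        using t s f by (auto simp: nat_trans_def)
      have "Comp D (Comp D (s (Cod C f)) (t (Cod C f))) (Fm F f)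
          = Comp D (s (Cod C f)) (Comp D (Fm G f) (t (Dom C f)))"
        using ob tX Ff nt(1) by (simp flip: assocD)
      also have "\<dots> = Comp D (Comp D (Fm H f) (s (Dom C f))) (t (Dom C f))"
        using ob tX Ff by (simp add: assocD nt(2))
      also have "\<dots> = Comp D (Fm H f) (Comp D (s (Dom C f)) (t (Dom C f)))"
        using ob tX Ff by (simp add: assocD)
      finally show ?thesis .
    qed
    then show ?thesis
      using t s tX compD dom_cod by (auto simp: nat_trans_def hom_def)
  qed
  have nt: "is_functor C D F" "is_functor C D G" "t \<in> extensional (Obj C)"
    "\<And>X. X \<in> Obj C \<Longrightarrow> t X \<in> Arr D" "\<And>X. X \<in> Obj C \<Longrightarrow> Dom D (t X) = Fo F X"
    "\<And>X. X \<in> Obj C \<Longrightarrow> Cod D (t X) = Fo G X" if "nat_trans C D F G t" for F G t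
    using that by (auto simp: nat_trans_def hom_def)
  have idl: "(\<lambda>X \<in> Obj C. Comp D (t X) ((\<lambda>X \<in> Obj C. Ident D (Fo F X)) X)) = t"
    and idr: "(\<lambda>X \<in> Obj C. Comp D ((\<lambda>X \<in> Obj C. Ident D (Fo G X)) X) (t X)) = t"
    if "nat_trans C D F G t" for F G t
    using nt[OF that] idD by (auto simp: fun_eq_iff extensional_def) (metis, metis)
  show ?thesis
    unfolding category_def
    apply (intro conjI ballI impI)
    subgoal using nt by (auto simp: simps)
    subgoal using nt by (auto simp: simps)
    subgoal using ident by (auto simp: simps)
    subgoal using comp by (auto simp: simps)
    subgoal using idl by (auto simp: simps)
    subgoal using idr by (auto simp: simps)
    subgoal using nt assocD by (auto simp: simps fun_eq_iff)
    done
qed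

end

theory Submission
  imports Defs
begin

text \<open>If principal down-sets are finite, then every presheaf is the directed union of its
  finite subpresheaves, so the finitely presentable presheaves are exactly those with finitely
  many elements, and the number of elements is a grade. A grade strictly decreases along
  descending chains of subobjects and is bounded and strictly increasing along descending chains
  of strong quotients, so graduated categories are DCC. Conversely, in a DCC category some
  finitely presentable presheaf \<open>P\<close> has an element at \<open>a\<close>; it embeds the subterminal presheaves
  of all down-sets below \<open>a\<close> in \<open>P\<close>. These are then finitely presentable, hence finitely
  generated, and the descending chain condition forces the down-set of \<open>a\<close> to be finite.\<close>

section \<open>Small sets\<close>

text \<open>A universe need not be closed under power sets, so smallness is derived only for
  products, finite lists and sets of finite subsets. Moreover, the finite presheaves with elements
  anywhere in the type \<open>'u\<close> need not form a small set, whereas the generators must;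
  hence finite subpresheaves are renamed to take their elements from one fixed countable set.

  One argument serves both directions: if a finitely presentable \<open>X\<close> is a directed
  union of subpresheaves, its identity factors through one of them, which is then all of
  \<open>X\<close>. It is applied to the finite subpresheaves, and to the down-sets generated by
  finite subsets.

  The definitions speak of arbitrary colimits, known only by their universal property, while the
  argument needs elements. So colimits are built explicitly, fibre by fibre, and every colimit is
  compared with the built one. This also finds the presheaf with an element at \<open>a\<close>: the
  representable at \<open>a\<close> is a directed colimit of finitely presentable presheaves, and
  its element at \<open>a\<close> must come from one of them.\<close>

lemma small_lepoll: "B \<lesssim> B' \<Longrightarrow> small U B' \<Longrightarrow> small U B"
  unfolding small_def using lepoll_trans by blast

lemma small_subset: "B \<subseteq> B' \<Longrightarrow> small U B' \<Longrightarrow> small U B"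
  using small_lepoll subset_imp_lepoll by blast

lemma small_image: "small U B \<Longrightarrow> small U (f ` B)"
  using small_lepoll image_lepoll by blast

lemma small_in_universe:
  assumes "universe U" "small U B"
  shows "B \<in> U"
  using assms by (auto simp: universe_def small_def)

lemma universe_small: "B \<in> U \<Longrightarrow> small U B"
  by (auto simp: small_def)

text \<open>Members of \<open>U\<close> are sets over \<open>'u\<close>, while object sets of shapes
  and sets of pairs or of subsets live in other types. The injection moves a small set of any type
  into \<open>U\<close>.\<close>

lemma small_encoding:
  fixes B :: "'b set" and U :: "'u set set"
  assumes "universe U" "small U B"
  obtains g :: "'b \<Rightarrow> 'u" where "inj_on g B" "g ` B \<in> U"
proof -
  obtain K g where "K \<in> U" "inj_on g B" "g ` B \<subseteq> K"
    using assms(2) by (auto simp: small_def lepoll_def)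
  moreover have "g ` B \<in> U"
    using small_in_universe[OF assms(1) small_subset[OF \<open>g ` B \<subseteq> K\<close> universe_small[OF \<open>K \<in> U\<close>]]] .
  ultimately show thesis
    using that by blast
qed

text \<open>The universe allows unions indexed by one of its members; an index set of another type
  is replaced by its encoding.\<close>

lemma small_UN:
  fixes B :: "'b set" and U :: "'u set set"
  assumes U: "universe U" and B: "small U B" and F: "\<And>b. b \<in> B \<Longrightarrow> F b \<in> U"
  shows "(\<Union>b\<in>B. F b) \<in> U"
proof -
  obtain g :: "'b \<Rightarrow> 'u" where g: "inj_on g B" "g ` B \<in> U"
    using small_encoding[OF U B] .
  have "(\<Union>x\<in>g ` B. F (inv_into B g x)) \<in> U"
    using U g F unfolding universe_def by (metis (no_types, lifting) inv_into_into)
  moreover have "(\<Union>x\<in>g ` B. F (inv_into B g x)) = (\<Union>b\<in>B. F b)"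
    using g(1) by simp
  ultimately show ?thesis
    by simp
qed

lemma small_nat:
  assumes "universe U"
  shows "small U (UNIV :: nat set)"
  using assms by (auto simp: universe_def small_def infinite_le_lepoll)

lemma small_finite: "universe U \<Longrightarrow> finite B \<Longrightarrow> small U B"
  by (metis finite_lepoll_infinite small_def universe_def)

lemma lepoll_linear: "A \<lesssim> B \<or> B \<lesssim> A"
  using ordLeq_total[OF card_of_Well_order card_of_Well_order, of A B]
  by (metis card_of_ordLeq lepoll_def)

lemma infinite_Times_lepoll: "infinite K \<Longrightarrow> K \<times> K \<lesssim> K"
  by (metis card_of_Times_same_infinite eqpoll_iff_card_of_ordIso eqpoll_imp_lepoll)

text \<open>An infinite bound absorbs products with itself, which is what products and lists require
  below.\<close>

lemma small_infinite:
  assumes "universe U" "small U B"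
  obtains K where "K \<in> U" "infinite K" "B \<lesssim> K"
proof -
  obtain X where X: "X \<in> U" "infinite X"
    using assms by (auto simp: universe_def)
  obtain K where K: "K \<in> U" "B \<lesssim> K"
    using assms by (auto simp: small_def)
  show thesis
  proof (cases "finite K")
    case True
    then show thesis
      using that X K finite_lepoll_infinite lepoll_trans by blast
  qed (use that K in blast)
qed

text \<open>Cardinals are comparable, so the larger of two infinite bounds dominates both factors
  and, being infinite, also its own square.\<close>

lemma small_Times:
  assumes U: "universe U" and B: "small U B" and D: "small U D"
  shows "small U (B \<times> D)"
proof -
  obtain K where K: "K \<in> U" "infinite K" "B \<lesssim> K"
    using small_infinite[OF U B] .
  obtain L where L: "L \<in> U" "infinite L" "D \<lesssim> L"
    using small_infinite[OF U D] .
  obtain M where M: "M \<in> U" "infinite M" "B \<lesssim> M" "D \<lesssim> M"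
    using K L lepoll_linear[of K L] lepoll_trans[of B K L] lepoll_trans[of D L K] by metis
  have "B \<times> D \<lesssim> M"
    using times_lepoll_mono[OF M(3,4)] infinite_Times_lepoll[OF M(2)] lepoll_trans by blast
  then show ?thesis
    using M(1) by (auto simp: small_def)
qed

text \<open>A disjoint union embeds in the product of the index set with the ordinary union.\<close>

lemma small_Sigma:
  assumes U: "universe U" and B: "small U B" and F: "\<And>b. b \<in> B \<Longrightarrow> F b \<in> U"
  shows "small U (Sigma B F)"
  by (rule small_subset[OF _ small_Times[OF U B universe_small[OF small_UN[OF U B F]]]]) auto

text \<open>Folding an injection of \<open>K \<times> K\<close> into \<open>K\<close> over a list,
  starting from a base point \<open>k\<close>, codes the list by a member of \<open>K\<close>. The
  code may confuse lists of different lengths, so the length is recorded beside it.\<close>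

lemma small_lists:
  assumes U: "universe U" and B: "small U B"
  shows "small U (lists B)"
proof -
  obtain K where K: "K \<in> U" "infinite K" "B \<lesssim> K"
    using small_infinite[OF U B] .
  obtain p where p: "inj_on p (K \<times> K)" "p ` (K \<times> K) \<subseteq> K"
    using infinite_Times_lepoll[OF K(2)] by (auto simp: lepoll_def)
  obtain k where k: "k \<in> K"
    using K(2) by (metis ex_in_conv finite.emptyI)
  define code where "code = foldr (\<lambda>x c. p (x, c))"
  have code_in: "code xs k \<in> K" if "xs \<in> lists K" for xs
    using that p(2) k by (induction xs) (auto simp: code_def)
  have code_inj: "xs = ys"
    if "xs \<in> lists K" "ys \<in> lists K" "length xs = length ys" "code xs k = code ys k" for xs ys
    using that
  proof (induction xs arbitrary: ys rule: list.induct)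
    case (Cons x xs)
    then obtain y ys' where ys: "ys = y # ys'"
      by (cases ys) auto
    have "p (x, code xs k) = p (y, code ys' k)"
      using Cons.prems ys by (simp add: code_def)
    moreover have "x \<in> K" "xs \<in> lists K" "y \<in> K" "ys' \<in> lists K"
      using Cons.prems ys by auto
    ultimately have "x = y \<and> code xs k = code ys' k"
      using inj_onD[OF p(1), of "(x, code xs k)" "(y, code ys' k)"] code_in[of xs] code_in[of ys']
      by simp
    then show ?case
      using Cons.IH[of ys'] Cons.prems ys by simp
  qed simp
  have "inj_on (\<lambda>xs. (length xs, code xs k)) (lists K)"
    unfolding inj_on_def prod.inject using code_inj by blast
  moreover have "(\<lambda>xs. (length xs, code xs k)) ` lists K \<subseteq> UNIV \<times> K"
    using code_in by blast
  ultimately have "lists K \<lesssim> (UNIV :: nat set) \<times> K"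
    unfolding lepoll_def by blast
  then have "small U (lists K)"
    using small_lepoll small_Times[OF U small_nat[OF U] universe_small[OF K(1)]] by blast
  then show ?thesis
    using small_lepoll lists_lepoll_mono[OF K(3)] by blast
qed

text \<open>Each finite subset is the set of entries of a list, so there are at most as many as
  lists.\<close>

lemma small_Fpow:
  assumes U: "universe U" and B: "small U B"
  shows "small U (Fpow B)"
proof -
  have "Fpow B \<subseteq> set ` lists B"
  proof (rule subsetI)
    fix E assume E: "E \<in> Fpow B"
    then obtain xs where "set xs = E"
      using finite_list by (auto simp: Fpow_def)
    then show "E \<in> set ` lists B"
      using E by (intro image_eqI[of _ _ xs]) (simp_all add: Fpow_def lists_eq_set)
  qed
  then show ?thesis
    by (rule small_subset[OF _ small_image[OF small_lists[OF U B]]])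
qed


section \<open>Arrows in a category\<close>

lemma comp_hom: "category C \<Longrightarrow> f \<in> hom C X Y \<Longrightarrow> g \<in> hom C Y Z \<Longrightarrow> Comp C g f \<in> hom C X Z"
  by (auto simp: category_def hom_def)

lemma comp_assoc:
  "category C \<Longrightarrow> f \<in> hom C W X \<Longrightarrow> g \<in> hom C X Y \<Longrightarrow> h \<in> hom C Y Z \<Longrightarrow>
    Comp C h (Comp C g f) = Comp C (Comp C h g) f"
  by (auto simp: category_def hom_def)

lemma ident_hom: "category C \<Longrightarrow> X \<in> Obj C \<Longrightarrow> Ident C X \<in> hom C X X"
  by (auto simp: category_def)

lemma comp_ident: "category C \<Longrightarrow> f \<in> hom C X Y \<Longrightarrow> Comp C f (Ident C X) = f"
  by (auto simp: category_def hom_def)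

lemma ident_comp: "category C \<Longrightarrow> f \<in> hom C X Y \<Longrightarrow> Comp C (Ident C Y) f = f"
  by (auto simp: category_def hom_def)

lemma hom_Obj: "category C \<Longrightarrow> f \<in> hom C X Y \<Longrightarrow> X \<in> Obj C \<and> Y \<in> Obj C"
  by (auto simp: category_def hom_def)

lemma arr_hom: "f \<in> Arr C \<Longrightarrow> f \<in> hom C (Dom C f) (Cod C f)"
  by (auto simp: hom_def)

lemma homD: "f \<in> hom C X Y \<Longrightarrow> f \<in> Arr C \<and> Dom C f = X \<and> Cod C f = Y"
  by (auto simp: hom_def)

section \<open>Cancellation of monomorphisms and strong epimorphisms\<close>

lemma mono_arrI:
  assumes "m \<in> hom C X Y"
    and "\<And>W g h. g \<in> hom C W X \<Longrightarrow> h \<in> hom C W X \<Longrightarrow> Comp C m g = Comp C m h \<Longrightarrow> g = h"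
  shows "mono_arr C m"
  using assms by (auto simp: mono_arr_def hom_def)

lemma mono_arrD:
  assumes "mono_arr C m" "m \<in> hom C X Y" "category C"
    and "g \<in> hom C W X" "h \<in> hom C W X" "Comp C m g = Comp C m h"
  shows "g = h"
  using assms hom_Obj[OF assms(3,4)] homD[OF assms(2)] unfolding mono_arr_def by auto

lemma epi_arrD:
  assumes "epi_arr C e" "e \<in> hom C X Y" "category C"
    and "g \<in> hom C Y W" "h \<in> hom C Y W" "Comp C g e = Comp C h e"
  shows "g = h"
  using assms hom_Obj[OF assms(3,4)] homD[OF assms(2)] unfolding epi_arr_def by auto

lemma iso_arrE:
  assumes "iso_arr C f" "f \<in> hom C X Y"
  obtains g where "g \<in> hom C Y X" "Comp C g f = Ident C X" "Comp C f g = Ident C Y"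
  using assms by (auto simp: iso_arr_def hom_def)

lemma mono_arr_cancel:
  assumes C: "category C" and f: "f \<in> hom C X Y" and g: "g \<in> hom C Y Z"
    and m: "mono_arr C (Comp C g f)"
  shows "mono_arr C f"
proof (rule mono_arrI[OF f])
  fix W p q assume pq: "p \<in> hom C W X" "q \<in> hom C W X" "Comp C f p = Comp C f q"
  then have "Comp C (Comp C g f) p = Comp C (Comp C g f) q"
    using comp_assoc[OF C _ f g] by metis
  then show "p = q"
    using mono_arrD[OF m comp_hom[OF C f g] C pq(1,2)] by blast
qed

text \<open>A square from \<open>g\<close> to a monomorphism \<open>m\<close> becomes a square from
  the composite by precomposing \<open>u\<close> with \<open>f\<close>. Its diagonal
  \<open>d\<close> satisfies the lower triangle already; the upper one follows by cancelling
  \<open>m\<close>.\<close>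

lemma strong_epi_arr_cancel:
  assumes C: "category C" and f: "f \<in> hom C X Y" and g: "g \<in> hom C Y Z"
    and e: "strong_epi_arr C (Comp C g f)"
  shows "strong_epi_arr C g"
proof -
  have gf: "Comp C g f \<in> hom C X Z"
    using comp_hom[OF C f g] .
  have gfep: "epi_arr C (Comp C g f)"
    using e by (simp add: strong_epi_arr_def)
  have ep: "p = q" if "p \<in> hom C Z W" "q \<in> hom C Z W" "Comp C p g = Comp C q g" for p q W
    using that comp_assoc[OF C f g] epi_arrD[OF gfep gf C] by metis
  have "\<exists>d \<in> hom C Z S. Comp C d g = u \<and> Comp C m d = v"
    if m: "mono_arr C m" "m \<in> hom C S T" and u: "u \<in> hom C Y S" and v: "v \<in> hom C Z T"
      and eq: "Comp C m u = Comp C v g" for m u v S T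
  proof -
    have "Comp C m (Comp C u f) = Comp C v (Comp C g f)"
      using comp_assoc[OF C f u m(2)] comp_assoc[OF C f g v] eq by simp
    then obtain d where d: "d \<in> hom C Z S" "Comp C m d = v"
      using e m v comp_hom[OF C f u] homD[OF gf] homD[OF m(2)]
      unfolding strong_epi_arr_def by blast
    have "Comp C m (Comp C d g) = Comp C m u"
      using d eq comp_assoc[OF C g d(1) m(2)] by simp
    then have "Comp C d g = u"
      using mono_arrD[OF m(1,2) C comp_hom[OF C g d(1)] u] by blast
    then show ?thesis
      using d by blast
  qed
  moreover have "epi_arr C g"
    using ep homD[OF g] unfolding epi_arr_def by auto
  ultimately show ?thesis
    using homD[OF g] unfolding strong_epi_arr_def by (metis arr_hom mono_arr_def)
qed

section \<open>Grades bound descending chains\<close>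

lemma graduated_imp_DCC:
  assumes "graduated_category U C"
  shows "DCC_category U C"
proof -
  have lfp: "locally_finitely_presentable U C"
    using assms by (simp add: graduated_category_def)
  then have C: "category C"
    by (simp add: locally_finitely_presentable_def)
  obtain grade :: "_ \<Rightarrow> nat" where
    sub: "\<And>X m. finitely_presentable U C X \<Longrightarrow> m \<in> subobjects C X \<Longrightarrow>
        finitely_presentable U C (Dom C m) \<and> grade (Dom C m) \<le> grade X \<and>
        (\<not> iso_arr C m \<longrightarrow> grade (Dom C m) < grade X)" and
    quo: "\<And>X e. finitely_presentable U C X \<Longrightarrow> e \<in> strong_quotients C X \<Longrightarrow>
        finitely_presentable U C (Cod C e) \<and> grade (Cod C e) \<le> grade X \<and>
        (\<not> iso_arr C e \<longrightarrow> grade (Cod C e) < grade X)"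
    using assms unfolding graduated_category_def by metis
  have subs: "descending_chains_finite (sub_le C) (subobjects C X)"
    if X: "finitely_presentable U C X" for X
    unfolding descending_chains_finite_def
  proof
    assume "\<exists>s. (\<forall>n. s n \<in> subobjects C X) \<and>
      (\<forall>n. sub_le C (s (Suc n)) (s n) \<and> \<not> sub_le C (s n) (s (Suc n)))"
    then obtain s where s: "\<And>n. s n \<in> subobjects C X" "\<And>n. sub_le C (s (Suc n)) (s n)"
      "\<And>n. \<not> sub_le C (s n) (s (Suc n))"
      by blast
    have shom: "s n \<in> hom C (Dom C (s n)) X" for n
      using s(1)[of n] by (auto simp: subobjects_def mono_arr_def hom_def)
    \<comment> \<open>The comparison \<open>h\<close> between consecutive subobjects of
      \<open>X\<close> is itself a subobject, of the domain of \<open>s n\<close>. It is proper,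
      since an inverse of \<open>h\<close> would reverse the comparison.\<close>
    have dec: "grade (Dom C (s (Suc n))) < grade (Dom C (s n))" for n
    proof -
      obtain h where h: "h \<in> hom C (Dom C (s (Suc n))) (Dom C (s n))" "s (Suc n) = Comp C (s n) h"
        using s(2)[of n] by (auto simp: sub_le_def)
      have "mono_arr C h"
        using mono_arr_cancel[OF C h(1) shom[of n]] h(2) s(1)[of "Suc n"]
        by (simp add: subobjects_def)
      then have "h \<in> subobjects C (Dom C (s n))"
        using homD[OF h(1)] by (simp add: subobjects_def)
      moreover have "\<not> iso_arr C h"
      proof
        assume "iso_arr C h"
        then obtain g where g: "g \<in> hom C (Dom C (s n)) (Dom C (s (Suc n)))"
          "Comp C h g = Ident C (Dom C (s n))"
          using iso_arrE[OF _ h(1)] by blast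
        have "s n = Comp C (s (Suc n)) g"
          using comp_assoc[OF C g(1) h(1) shom[of n]] g(2) h(2) comp_ident[OF C shom[of n]] by simp
        then show False
          using s(3)[of n] g(1) by (auto simp: sub_le_def)
      qed
      moreover have "finitely_presentable U C (Dom C (s n))"
        using sub[OF X s(1)] by blast
      ultimately show ?thesis
        using sub homD[OF h(1)] by metis
    qed
    then show False
      using wf_no_infinite_down_chainE[OF wf, of "\<lambda>n. grade (Dom C (s n))"] by auto
  qed
  have quots: "descending_chains_finite (quot_le C) (strong_quotients C X)"
    if X: "finitely_presentable U C X" for X
    unfolding descending_chains_finite_def
  proof
    assume "\<exists>s. (\<forall>n. s n \<in> strong_quotients C X) \<and>
      (\<forall>n. quot_le C (s (Suc n)) (s n) \<and> \<not> quot_le C (s n) (s (Suc n)))"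
    then obtain s where s: "\<And>n. s n \<in> strong_quotients C X" "\<And>n. quot_le C (s (Suc n)) (s n)"
      "\<And>n. \<not> quot_le C (s n) (s (Suc n))"
      by blast
    have shom: "s n \<in> hom C X (Cod C (s n))" for n
      using s(1)[of n] by (auto simp: strong_quotients_def strong_epi_arr_def epi_arr_def hom_def)
    \<comment> \<open>For quotients the comparison runs from the later codomain onto the earlier
      one, so the earlier is a proper strong quotient of the later and grades go up along the
      chain.\<close>
    have inc: "grade (Cod C (s n)) < grade (Cod C (s (Suc n)))" for n
    proof -
      obtain h where h: "h \<in> hom C (Cod C (s (Suc n))) (Cod C (s n))" "s n = Comp C h (s (Suc n))"
        using s(2)[of n] by (auto simp: quot_le_def)
      have "strong_epi_arr C h"
        using strong_epi_arr_cancel[OF C shom[of "Suc n"] h(1)] h(2) s(1)[of n]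
        by (simp add: strong_quotients_def)
      then have "h \<in> strong_quotients C (Cod C (s (Suc n)))"
        using homD[OF h(1)] by (simp add: strong_quotients_def)
      moreover have "\<not> iso_arr C h"
      proof
        assume "iso_arr C h"
        then obtain g where g: "g \<in> hom C (Cod C (s n)) (Cod C (s (Suc n)))"
          "Comp C g h = Ident C (Cod C (s (Suc n)))"
          using iso_arrE[OF _ h(1)] by blast
        have "s (Suc n) = Comp C g (s n)"
          using comp_assoc[OF C shom[of "Suc n"] h(1) g(1)] g(2) h(2)
            ident_comp[OF C shom[of "Suc n"]] by simp
        then show False
          using s(3)[of n] g(1) by (auto simp: quot_le_def)
      qed
      moreover have "finitely_presentable U C (Cod C (s (Suc n)))"
        using quo[OF X s(1)] by blast
      ultimately show ?thesis
        using quo homD[OF h(1)] by metis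
    qed
    \<comment> \<open>A strictly increasing sequence of natural numbers is unbounded, yet every
      \<open>s n\<close> is a strong quotient of the same \<open>X\<close>.\<close>
    have "n \<le> grade (Cod C (s n))" for n
      by (induction n) (use inc in \<open>auto simp: Suc_le_eq intro: le_less_trans\<close>)
    moreover have "grade (Cod C (s n)) \<le> grade X" for n
      using quo[OF X s(1)] by blast
    ultimately show False
      using order_trans not_less_eq_eq by metis
  qed
  show ?thesis
    unfolding DCC_category_def using lfp sub quo subs quots by blast
qed


section \<open>Hom-functors and directed colimits\<close>

lemma poset_cat_simps [simp]:
  "Obj (poset_cat A r) = A" "Arr (poset_cat A r) = r" "Dom (poset_cat A r) = fst"
  "Cod (poset_cat A r) = snd" "Ident (poset_cat A r) = (\<lambda>a. (a, a))"
  "Comp (poset_cat A r) = (\<lambda>g f. (fst f, snd g))"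
  by (simp_all add: poset_cat_def)

lemma is_functor_hom:
  assumes "is_functor J C D" "f \<in> Arr J"
  shows "Fm D f \<in> hom C (Fo D (Dom J f)) (Fo D (Cod J f))"
  using assms by (auto simp: is_functor_def)

lemma is_functor_Obj: "is_functor J C D \<Longrightarrow> j \<in> Obj J \<Longrightarrow> Fo D j \<in> Obj C"
  by (auto simp: is_functor_def)

lemma cocone_hom: "cocone J C D V c \<Longrightarrow> j \<in> Obj J \<Longrightarrow> c j \<in> hom C (Fo D j) V"
  by (auto simp: cocone_def)

lemma cocone_comp:
  "cocone J C D V c \<Longrightarrow> f \<in> Arr J \<Longrightarrow> Comp C (c (Cod J f)) (Fm D f) = c (Dom J f)"
  by (auto simp: cocone_def)

lemma is_colimit_cocone: "is_colimit J C D V c \<Longrightarrow> cocone J C D V c"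
  by (simp add: is_colimit_def)

lemma is_colimit_unique:
  assumes "is_colimit J C D V c" "cocone J C D V' c'"
    and "h \<in> hom C V V'" "\<And>j. j \<in> Obj J \<Longrightarrow> Comp C h (c j) = c' j"
    and "k \<in> hom C V V'" "\<And>j. j \<in> Obj J \<Longrightarrow> Comp C k (c j) = c' j"
  shows "h = k"
  using assms unfolding is_colimit_def by blast

lemma is_colimit_factor:
  assumes "is_colimit J C D V c" "cocone J C D V' c'"
  obtains h where "h \<in> hom C V V'" "\<And>j. j \<in> Obj J \<Longrightarrow> Comp C h (c j) = c' j"
proof -
  have "\<exists>h. h \<in> hom C V V' \<and> (\<forall>j\<in>Obj J. Comp C h (c j) = c' j)"
    using assms unfolding is_colimit_def by blast
  then show thesis
    using that by blast
qed

text \<open>The composite of the two induced arrows agrees with the identity on all legs. The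
  recorded equation exhibits \<open>V\<close> as a retract of \<open>V'\<close>, which is what later
  transfers the pointwise description from \<open>V'\<close> to \<open>V\<close>.\<close>

lemma colimit_comparison_inverse:
  assumes C: "category C" and J: "category J" and D: "is_functor J C D"
    and c: "is_colimit J C D V c" and c': "is_colimit J C D V' c'"
  obtains h k where "h \<in> hom C V V'" "k \<in> hom C V' V"
    "\<And>j. j \<in> Obj J \<Longrightarrow> Comp C h (c j) = c' j" "\<And>j. j \<in> Obj J \<Longrightarrow> Comp C k (c' j) = c j"
    "Comp C k h = Ident C V"
proof -
  note cc = is_colimit_cocone[OF c] and cc' = is_colimit_cocone[OF c']
  obtain h where h: "h \<in> hom C V V'" "\<And>j. j \<in> Obj J \<Longrightarrow> Comp C h (c j) = c' j"
    by (rule is_colimit_factor[OF c cc']) blast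
  obtain k where k: "k \<in> hom C V' V" "\<And>j. j \<in> Obj J \<Longrightarrow> Comp C k (c' j) = c j"
    by (rule is_colimit_factor[OF c' cc]) blast
  have "Comp C k h = Ident C V"
  proof (rule is_colimit_unique[OF c cc])
    show "Comp C (Comp C k h) (c j) = c j" if "j \<in> Obj J" for j
      using comp_assoc[OF C cocone_hom[OF cc that] h(1) k(1)] h(2) k(2) that by simp
    show "Comp C (Ident C V) (c j) = c j" if "j \<in> Obj J" for j
      using ident_comp[OF C cocone_hom[OF cc that]] .
  qed (use comp_hom[OF C h(1) k(1)] ident_hom[OF C] hom_Obj[OF C h(1)] in auto)
  then show thesis
    using that h k by blast
qed

lemma set_cat_simps [simp]:
  "Obj (set_cat U) = U" "Ident (set_cat U) = (\<lambda>X. (X, \<lambda>x\<in>X. x, X))"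
  "Comp (set_cat U) (Y', g, Z) (X, f, Y) = (X, compose X g f, Z)"
  by (simp_all add: set_cat_def)

lemma set_cat_hom:
  "m \<in> hom (set_cat U) X Y \<longleftrightarrow> X \<in> U \<and> Y \<in> U \<and> (\<exists>f \<in> X \<rightarrow>\<^sub>E Y. m = (X, f, Y))"
  by (auto simp: set_cat_def hom_def)

text \<open>This is the elementwise criterion for a directed colimit of sets: \<open>surj\<close>
  says that each arrow into \<open>V\<close> comes from a stage, \<open>inj\<close> that two arrows
  from stages with the same image are identified at a later stage.\<close>

lemma hom_functor_colimitI:
  assumes C: "category C" and I: "directed_poset I le"
    and D: "is_functor (poset_cat I le) C D" and c: "cocone (poset_cat I le) C D V c"
    and X: "X \<in> Obj C"
    and surj: "\<And>t. t \<in> hom C X V \<Longrightarrow> \<exists>i\<in>I. \<exists>s\<in>hom C X (Fo D i). Comp C (c i) s = t"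
    and inj: "\<And>i k s s'. i \<in> I \<Longrightarrow> k \<in> I \<Longrightarrow> s \<in> hom C X (Fo D i) \<Longrightarrow> s' \<in> hom C X (Fo D k) \<Longrightarrow>
      Comp C (c i) s = Comp C (c k) s' \<Longrightarrow>
      \<exists>l. (i, l) \<in> le \<and> (k, l) \<in> le \<and> Comp C (Fm D (i, l)) s = Comp C (Fm D (k, l)) s'"
  shows "is_colimit (poset_cat I le) (set_cat UNIV)
     (comp_ftor (poset_cat I le) (hom_functor C X) D)
     (Fo (hom_functor C X) V) (\<lambda>i. Fm (hom_functor C X) (c i))"
proof -
  let ?D = "comp_ftor (poset_cat I le) (hom_functor C X) D"
  have le: "i \<in> I" "j \<in> I" if "(i, j) \<in> le" for i j
    using I that by (auto simp: directed_poset_def partial_order_on_def preorder_on_def)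
  have V: "V \<in> Obj C"
    using c by (simp add: cocone_def)
  have Di: "Fo D i \<in> Obj C" if "i \<in> I" for i
    using is_functor_Obj[OF D] that by simp
  have Dm: "Fm D (i, j) \<in> hom C (Fo D i) (Fo D j)" if "(i, j) \<in> le" for i j
    using is_functor_hom[OF D] that by fastforce
  have ch: "c i \<in> hom C (Fo D i) V" if "i \<in> I" for i
    using cocone_hom[OF c] that by simp
  have cc: "Comp C (c j) (Fm D (i, j)) = c i" if "(i, j) \<in> le" for i j
    using cocone_comp[OF c, of "(i, j)"] that by simp
  have V': "Fo (hom_functor C X) V = hom C X V"
    using V by (simp add: hom_functor_def)
  have Fo': "Fo ?D i = hom C X (Fo D i)" if "i \<in> I" for i
    using that Di by (simp add: comp_ftor_def hom_functor_def)
  have Fm': "Fm ?D (i, j) = (hom C X (Fo D i), \<lambda>s\<in>hom C X (Fo D i). Comp C (Fm D (i, j)) s,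
      hom C X (Fo D j))" if "(i, j) \<in> le" for i j
    using that homD[OF Dm[OF that]] by (simp add: comp_ftor_def hom_functor_def)
  have c': "Fm (hom_functor C X) (c i) = (hom C X (Fo D i), \<lambda>s\<in>hom C X (Fo D i). Comp C (c i) s,
      hom C X V)" if "i \<in> I" for i
    using homD[OF ch[OF that]] by (simp add: hom_functor_def)
  have "cocone (poset_cat I le) (set_cat UNIV) ?D (Fo (hom_functor C X) V)
    (\<lambda>i. Fm (hom_functor C X) (c i))"
    unfolding cocone_def
  proof (intro conjI ballI)
    show "Fm (hom_functor C X) (c j) \<in> hom (set_cat UNIV) (Fo ?D j) (Fo (hom_functor C X) V)"
      if "j \<in> Obj (poset_cat I le)" for j
      using that c' Fo' V' comp_hom[OF C _ ch] by (auto simp: set_cat_hom)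
    show "Comp (set_cat UNIV) (Fm (hom_functor C X) (c (Cod (poset_cat I le) f))) (Fm ?D f)
        = Fm (hom_functor C X) (c (Dom (poset_cat I le) f))"
      if f0: "f \<in> Arr (poset_cat I le)" for f
    proof -
      obtain i j where f: "f = (i, j)" "(i, j) \<in> le"
        using f0 by (cases f) auto
      have "Comp C (c j) (Comp C (Fm D (i, j)) s) = Comp C (c i) s"
        if "s \<in> hom C X (Fo D i)" for s
        using comp_assoc[OF C that Dm[OF f(2)] ch] le[OF f(2)] cc[OF f(2)] by simp
      then show ?thesis
        using f le[OF f(2)] c' Fm' comp_hom[OF C _ Dm[OF f(2)]]
        by (auto simp: compose_def fun_eq_iff)
    qed
  qed simp
  moreover have "\<exists>!h. h \<in> hom (set_cat UNIV) (Fo (hom_functor C X) V) W \<and>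
      (\<forall>j \<in> Obj (poset_cat I le). Comp (set_cat UNIV) h (Fm (hom_functor C X) (c j)) = w j)"
    if w: "cocone (poset_cat I le) (set_cat UNIV) ?D W w" for W w
  proof -
    \<comment> \<open>\<open>\<gamma> j\<close> is the bare function underlying the leg
      \<open>w j\<close>.\<close>
    define \<gamma> where "\<gamma> j = fst (snd (w j))" for j
    have wj: "w j = (hom C X (Fo D j), \<gamma> j, W)" "\<gamma> j \<in> hom C X (Fo D j) \<rightarrow>\<^sub>E W" if "j \<in> I" for j
      using cocone_hom[OF w, of j] that Fo' by (auto simp: set_cat_hom \<gamma>_def)
    have \<gamma>comp: "\<gamma> j (Comp C (Fm D (i, j)) s) = \<gamma> i s"
      if ij: "(i, j) \<in> le" and s: "s \<in> hom C X (Fo D i)" for i j s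
    proof -
      have "compose (hom C X (Fo D i)) (\<gamma> j) (\<lambda>s\<in>hom C X (Fo D i). Comp C (Fm D (i, j)) s) = \<gamma> i"
        using cocone_comp[OF w, of "(i, j)"] ij le[OF ij] wj Fm' by simp
      from fun_cong[OF this, of s] show ?thesis
        using s by (simp add: compose_def)
    qed
    have \<gamma>eq: "\<gamma> i s = \<gamma> k s'"
      if "i \<in> I" "k \<in> I" "s \<in> hom C X (Fo D i)" "s' \<in> hom C X (Fo D k)"
        "Comp C (c i) s = Comp C (c k) s'" for i k s s'
      using inj[OF that] \<gamma>comp that by metis
    define P where "P t i s \<longleftrightarrow> i \<in> I \<and> s \<in> hom C X (Fo D i) \<and> Comp C (c i) s = t" for t i s
    \<comment> \<open>The value at \<open>t\<close> is read off from an arbitrary factorization of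
      \<open>t\<close> through a stage; \<open>\<gamma>eq\<close> shows independence of the
      choice.\<close>
    define \<eta> where "\<eta> t = (SOME y. \<exists>i s. P t i s \<and> y = \<gamma> i s)" for t
    have \<eta>: "\<eta> (Comp C (c i) s) = \<gamma> i s" if "i \<in> I" "s \<in> hom C X (Fo D i)" for i s
    proof -
      have "\<exists>i' s'. P (Comp C (c i) s) i' s' \<and> \<eta> (Comp C (c i) s) = \<gamma> i' s'"
        unfolding \<eta>_def by (rule someI_ex) (use that P_def in blast)
      then show ?thesis
        using \<gamma>eq that unfolding P_def by metis
    qed
    have \<eta>W: "\<eta> t \<in> W" if "t \<in> hom C X V" for t
      using surj[OF that] \<eta> wj(2) by (metis PiE_mem)
    let ?h = "(hom C X V, \<lambda>t\<in>hom C X V. \<eta> t, W)"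
    show ?thesis
    proof (rule ex1I[of _ ?h])
      have "compose (hom C X (Fo D j)) (\<lambda>t\<in>hom C X V. \<eta> t)
          (\<lambda>s\<in>hom C X (Fo D j). Comp C (c j) s) = \<gamma> j" if "j \<in> I" for j
        using \<eta>[OF that] wj(2)[OF that] comp_hom[OF C _ ch[OF that]]
        by (auto simp: compose_def fun_eq_iff PiE_def extensional_def)
      then show "?h \<in> hom (set_cat UNIV) (Fo (hom_functor C X) V) W \<and>
          (\<forall>j \<in> Obj (poset_cat I le). Comp (set_cat UNIV) ?h (Fm (hom_functor C X) (c j)) = w j)"
        using \<eta>W V' c' wj(1) by (auto simp: set_cat_hom)
    next
      fix h'
      assume h': "h' \<in> hom (set_cat UNIV) (Fo (hom_functor C X) V) W \<and>
          (\<forall>j \<in> Obj (poset_cat I le). Comp (set_cat UNIV) h' (Fm (hom_functor C X) (c j)) = w j)"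
      then obtain f where f: "h' = (hom C X V, f, W)" "f \<in> hom C X V \<rightarrow>\<^sub>E W"
        by (auto simp: set_cat_hom V')
      have fc: "f (Comp C (c j) s) = \<gamma> j s" if "j \<in> I" "s \<in> hom C X (Fo D j)" for j s
      proof -
        have "compose (hom C X (Fo D j)) f (\<lambda>s\<in>hom C X (Fo D j). Comp C (c j) s) = \<gamma> j"
          using h' f(1) that(1) c' wj(1) by auto
        from fun_cong[OF this, of s] show ?thesis
          using that by (simp add: compose_def)
      qed
      have "f t = \<eta> t" if t: "t \<in> hom C X V" for t
        using surj[OF t] \<eta> fc by metis
      then have "f = (\<lambda>t\<in>hom C X V. \<eta> t)"
        using f(2) by (auto simp: fun_eq_iff PiE_def extensional_def)
      then show "h' = ?h"
        using f(1) by simp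
    qed
  qed
  ultimately show ?thesis
    by (simp add: is_colimit_def)
qed

text \<open>Let \<open>T\<close> be the set of arrows into \<open>V\<close> that do factor through a
  stage. The legs of the colimit of hom-sets land in \<open>T\<close>, so the universal property
  gives a map into \<open>T\<close>. Followed by the inclusion of \<open>T\<close> it is the
  identity, hence \<open>T\<close> is everything.\<close>

lemma finitely_presentable_factor:
  fixes I :: "'u set" and U :: "'u set set"
  assumes C: "category C" and X: "finitely_presentable U C X"
    and I: "I \<in> U" "directed_poset I le"
    and D: "is_functor (poset_cat I le) C D" and c: "is_colimit (poset_cat I le) C D V c"
    and t: "t \<in> hom C X V"
  obtains i s where "i \<in> I" "s \<in> hom C X (Fo D i)" "Comp C (c i) s = t"
proof -
  let ?J = "poset_cat I le" and ?S = "set_cat UNIV"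
  let ?D = "comp_ftor ?J (hom_functor C X) D"
  let ?c = "\<lambda>i. Fm (hom_functor C X) (c i)"
  define T where "T = {t \<in> hom C X V. \<exists>i\<in>I. \<exists>s\<in>hom C X (Fo D i). Comp C (c i) s = t}"
  have le: "i \<in> I" "j \<in> I" if "(i, j) \<in> le" for i j
    using I(2) that by (auto simp: directed_poset_def partial_order_on_def preorder_on_def)
  note cc = is_colimit_cocone[OF c]
  have V: "V \<in> Obj C"
    using cc by (simp add: cocone_def)
  have ch: "c i \<in> hom C (Fo D i) V" if "i \<in> I" for i
    using cocone_hom[OF cc] that by simp
  have V': "Fo (hom_functor C X) V = hom C X V"
    using V by (simp add: hom_functor_def)
  have Fo': "Fo ?D i = hom C X (Fo D i)" if "i \<in> I" for i
    using that is_functor_Obj[OF D] by (simp add: comp_ftor_def hom_functor_def)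
  have c': "?c i = (hom C X (Fo D i), \<lambda>s\<in>hom C X (Fo D i). Comp C (c i) s, hom C X V)"
    if "i \<in> I" for i
    using homD[OF ch[OF that]] by (simp add: hom_functor_def)
  have col: "is_colimit ?J ?S ?D (hom C X V) ?c"
    using X I D c V' unfolding finitely_presentable_def by metis
  let ?cT = "\<lambda>i. (hom C X (Fo D i), \<lambda>s\<in>hom C X (Fo D i). Comp C (c i) s, T)"
  have inT: "Comp C (c i) s \<in> T" if "i \<in> I" "s \<in> hom C X (Fo D i)" for i s
    using that comp_hom[OF C that(2) ch[OF that(1)]] by (auto simp: T_def)
  have "cocone ?J ?S ?D T ?cT"
    unfolding cocone_def
  proof (intro conjI ballI)
    show "?cT j \<in> hom ?S (Fo ?D j) T" if "j \<in> Obj ?J" for j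
      using that inT Fo' by (auto simp: set_cat_hom)
    show "Comp ?S (?cT (Cod ?J f)) (Fm ?D f) = ?cT (Dom ?J f)" if f0: "f \<in> Arr ?J" for f
    proof -
      obtain i j where f: "f = (i, j)" "(i, j) \<in> le"
        using f0 by (cases f) auto
      have Dm: "Fm D (i, j) \<in> hom C (Fo D i) (Fo D j)"
        using is_functor_hom[OF D, of f] f by simp
      have "Fm ?D f = (hom C X (Fo D i), \<lambda>s\<in>hom C X (Fo D i). Comp C (Fm D (i, j)) s,
          hom C X (Fo D j))"
        using f homD[OF Dm] by (simp add: comp_ftor_def hom_functor_def)
      moreover have "Comp C (c j) (Comp C (Fm D (i, j)) s) = Comp C (c i) s"
        if "s \<in> hom C X (Fo D i)" for s
        using comp_assoc[OF C that Dm ch] le[OF f(2)] cocone_comp[OF cc, of f] f by simp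
      ultimately show ?thesis
        using f comp_hom[OF C _ Dm] by (auto simp: compose_def fun_eq_iff)
    qed
  qed simp
  then obtain h where h: "h \<in> hom ?S (hom C X V) T"
      "\<And>j. j \<in> I \<Longrightarrow> Comp ?S h (?c j) = ?cT j"
    by (rule is_colimit_factor[OF col]) simp
  then obtain f where f: "h = (hom C X V, f, T)" "f \<in> hom C X V \<rightarrow>\<^sub>E T"
    by (auto simp: set_cat_hom)
  have TV: "T \<subseteq> hom C X V"
    by (auto simp: T_def)
  \<comment> \<open>With its codomain enlarged from \<open>T\<close> to the full hom-set,
    \<open>f\<close> fixes all legs, just as the identity does.\<close>
  have "(hom C X V, f, hom C X V) = (hom C X V, \<lambda>t\<in>hom C X V. t, hom C X V)"
  proof (rule is_colimit_unique[OF col is_colimit_cocone[OF col]])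
    show "(hom C X V, f, hom C X V) \<in> hom ?S (hom C X V) (hom C X V)"
      using f(2) TV by (auto simp: set_cat_hom)
    show "Comp ?S (hom C X V, f, hom C X V) (?c j) = ?c j" if "j \<in> Obj ?J" for j
      using h(2)[of j] f(1) that c' by simp
    show "(hom C X V, \<lambda>t\<in>hom C X V. t, hom C X V) \<in> hom ?S (hom C X V) (hom C X V)"
      by (simp add: set_cat_hom)
    show "Comp ?S (hom C X V, \<lambda>t\<in>hom C X V. t, hom C X V) (?c j) = ?c j" if "j \<in> Obj ?J" for j
      using that c' comp_hom[OF C _ ch] by (auto simp: compose_def fun_eq_iff)
  qed
  then have "f t = t"
    using t by (metis prod.inject restrict_apply')
  then have "t \<in> T"
    using f(2) t by (metis PiE_mem)
  then show thesis
    using that by (auto simp: T_def)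
qed


section \<open>Presheaves on a poset\<close>

lemma op_cat_simps [simp]:
  "Obj (op_cat C) = Obj C" "Arr (op_cat C) = Arr C" "Dom (op_cat C) = Cod C"
  "Cod (op_cat C) = Dom C" "Ident (op_cat C) = Ident C" "Comp (op_cat C) g f = Comp C f g"
  by (simp_all add: op_cat_def)

type_synonym ('a, 'u) psh = "('a, 'a \<times> 'a, 'u set, 'u set \<times> ('u \<Rightarrow> 'u) \<times> 'u set) ftor"

type_synonym ('a, 'u) psh_arr =
  "('a, 'u) psh \<times> ('a \<Rightarrow> 'u set \<times> ('u \<Rightarrow> 'u) \<times> 'u set) \<times> ('a, 'u) psh"

text \<open>\<open>res F b a\<close> is the action of \<open>F\<close> on \<open>b \<le> a\<close>, a map from \<open>F a\<close> to \<open>F b\<close>.\<close>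

definition res :: "('a, 'u) psh \<Rightarrow> 'a \<Rightarrow> 'a \<Rightarrow> 'u \<Rightarrow> 'u" where
  "res F b a = fst (snd (Fm F (b, a)))"

definition app :: "('a, 'u) psh_arr \<Rightarrow> 'a \<Rightarrow> 'u \<Rightarrow> 'u" where
  "app m a = fst (snd (fst (snd m) a))"

locale presheaves =
  fixes A :: "'a set" and r :: "'a rel" and U :: "'u set set"
  assumes po: "partial_order_on A r" and univ: "universe U" and smallA: "small U A"
begin

abbreviation C where "C \<equiv> presheaf_cat U A r"

text \<open>Raw data are cut down to \<open>A\<close>, \<open>r\<close> and the fibres, as
  extensionality demands. Each presheaf is then \<open>mkpsh\<close> of its own fibres and
  restrictions, and likewise each arrow is \<open>mkarr\<close> of its components, so equality can
  be tested on elements.\<close>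

definition mkpsh :: "('a \<Rightarrow> 'u set) \<Rightarrow> ('a \<Rightarrow> 'a \<Rightarrow> 'u \<Rightarrow> 'u) \<Rightarrow> ('a, 'u) psh" where
  "mkpsh X \<rho> = \<lparr>Fo = \<lambda>a\<in>A. X a,
     Fm = \<lambda>f\<in>r. (X (snd f), \<lambda>x\<in>X (snd f). \<rho> (fst f) (snd f) x, X (fst f))\<rparr>"

definition mkarr :: "('a, 'u) psh \<Rightarrow> ('a \<Rightarrow> 'u \<Rightarrow> 'u) \<Rightarrow> ('a, 'u) psh \<Rightarrow> ('a, 'u) psh_arr" where
  "mkarr F \<tau> G = (F, \<lambda>a\<in>A. (Fo F a, \<lambda>x\<in>Fo F a. \<tau> a x, Fo G a), G)"

lemma refl_r: "a \<in> A \<Longrightarrow> (a, a) \<in> r"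
  using po by (auto simp: partial_order_on_def preorder_on_def refl_on_def)

lemma r_in_A: "(b, a) \<in> r \<Longrightarrow> b \<in> A" "(b, a) \<in> r \<Longrightarrow> a \<in> A"
  using po by (auto simp: partial_order_on_def preorder_on_def)

lemma trans_r: "(c, b) \<in> r \<Longrightarrow> (b, a) \<in> r \<Longrightarrow> (c, a) \<in> r"
  using po by (auto simp: partial_order_on_def preorder_on_def dest: transD)

lemma antisym_r: "(b, a) \<in> r \<Longrightarrow> (a, b) \<in> r \<Longrightarrow> a = b"
  using po by (auto simp: partial_order_on_def dest: antisymD)

lemma category_C: "category C"
  by (intro category_functor_cat category_op_cat category_poset_cat po category_set_cat)

lemma Obj_C: "F \<in> Obj C \<longleftrightarrow> is_functor (op_cat (poset_cat A r)) (set_cat U) F"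
  by (simp add: functor_cat_def)

lemma Fo_mkpsh [simp]: "a \<in> A \<Longrightarrow> Fo (mkpsh X \<rho>) a = X a"
  by (simp add: mkpsh_def)

lemma res_mkpsh [simp]: "(b, a) \<in> r \<Longrightarrow> x \<in> X a \<Longrightarrow> res (mkpsh X \<rho>) b a x = \<rho> b a x"
  by (simp add: mkpsh_def res_def)

lemma mkpsh_Obj:
  assumes "\<And>a. a \<in> A \<Longrightarrow> X a \<in> U"
    and "\<And>a b x. (b, a) \<in> r \<Longrightarrow> x \<in> X a \<Longrightarrow> \<rho> b a x \<in> X b"
    and "\<And>a x. a \<in> A \<Longrightarrow> x \<in> X a \<Longrightarrow> \<rho> a a x = x"
    and "\<And>a b c x. (b, a) \<in> r \<Longrightarrow> (c, b) \<in> r \<Longrightarrow> x \<in> X a \<Longrightarrow> \<rho> c b (\<rho> b a x) = \<rho> c a x"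
  shows "mkpsh X \<rho> \<in> Obj C"
  unfolding Obj_C is_functor_def
proof (intro conjI ballI impI)
  fix f assume f: "f \<in> Arr (op_cat (poset_cat A r))"
  then obtain b a where ab: "f = (b, a)" "(b, a) \<in> r"
    by (cases f) simp
  then show "Fm (mkpsh X \<rho>) f \<in> hom (set_cat U) (Fo (mkpsh X \<rho>) (Dom (op_cat (poset_cat A r)) f))
      (Fo (mkpsh X \<rho>) (Cod (op_cat (poset_cat A r)) f))"
    using assms(1,2) r_in_A[OF ab(2)] by (simp add: set_cat_hom mkpsh_def)
  fix g assume "g \<in> Arr (op_cat (poset_cat A r))"
    "Cod (op_cat (poset_cat A r)) f = Dom (op_cat (poset_cat A r)) g"
  then obtain c where "g = (c, b)" "(c, b) \<in> r"
    using ab by (cases g) simp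
  then show "Fm (mkpsh X \<rho>) (Comp (op_cat (poset_cat A r)) g f)
      = Comp (set_cat U) (Fm (mkpsh X \<rho>) g) (Fm (mkpsh X \<rho>) f)"
    using ab assms(2,4) trans_r by (simp add: mkpsh_def compose_def fun_eq_iff)
next
  fix a assume "a \<in> Obj (op_cat (poset_cat A r))"
  then show "Fm (mkpsh X \<rho>) (Ident (op_cat (poset_cat A r)) a)
      = Ident (set_cat U) (Fo (mkpsh X \<rho>) a)"
    using assms(3) refl_r by (simp add: mkpsh_def fun_eq_iff)
qed (use assms(1) in \<open>auto simp: mkpsh_def\<close>)

lemma psh_props:
  assumes "F \<in> Obj C"
  shows psh_U: "a \<in> A \<Longrightarrow> Fo F a \<in> U"
    and res_in: "(b, a) \<in> r \<Longrightarrow> x \<in> Fo F a \<Longrightarrow> res F b a x \<in> Fo F b"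
    and res_id: "a \<in> A \<Longrightarrow> x \<in> Fo F a \<Longrightarrow> res F a a x = x"
    and res_res: "(b, a) \<in> r \<Longrightarrow> (c, b) \<in> r \<Longrightarrow> x \<in> Fo F a \<Longrightarrow>
      res F c b (res F b a x) = res F c a x"
    and psh_Fm: "(b, a) \<in> r \<Longrightarrow> Fm F (b, a) = (Fo F a, res F b a, Fo F b)"
    and res_ext: "(b, a) \<in> r \<Longrightarrow> res F b a \<in> extensional (Fo F a)"
    and psh_Fo_ext: "Fo F \<in> extensional A"
    and psh_Fm_ext: "Fm F \<in> extensional r"
proof -
  have F: "is_functor (op_cat (poset_cat A r)) (set_cat U) F"
    using assms by (simp add: Obj_C)
  show FU: "Fo F a \<in> U" if "a \<in> A" for a
    using F that by (auto simp: is_functor_def)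
  have FmE: "Fm F (b, a) = (Fo F a, res F b a, Fo F b) \<and> res F b a \<in> Fo F a \<rightarrow>\<^sub>E Fo F b"
    if "(b, a) \<in> r" for b a
  proof -
    have "Fm F (b, a) \<in> hom (set_cat U) (Fo F a) (Fo F b)"
      using F that by (fastforce simp: is_functor_def)
    then show ?thesis
      by (auto simp: set_cat_hom res_def)
  qed
  then show Fm: "Fm F (b, a) = (Fo F a, res F b a, Fo F b)" if "(b, a) \<in> r" for b a
    using that by blast
  show "res F b a x \<in> Fo F b" if "(b, a) \<in> r" "x \<in> Fo F a" for b a x
    using FmE that by blast
  show "res F b a \<in> extensional (Fo F a)" if "(b, a) \<in> r" for b a
    using FmE[OF that] by (simp add: PiE_def)
  show "res F a a x = x" if "a \<in> A" "x \<in> Fo F a" for a x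
  proof -
    have "Fm F (a, a) = (Fo F a, \<lambda>x\<in>Fo F a. x, Fo F a)"
      using F that by (auto simp: is_functor_def)
    then show ?thesis
      using that by (simp add: res_def)
  qed
  show "res F c b (res F b a x) = res F c a x" if "(b, a) \<in> r" "(c, b) \<in> r" "x \<in> Fo F a" for a b c x
  proof -
    have "Fm F (c, a) = Comp (set_cat U) (Fm F (c, b)) (Fm F (b, a))"
      using F that unfolding is_functor_def by fastforce
    then show ?thesis
      using that Fm trans_r by (simp add: compose_def)
  qed
  show "Fo F \<in> extensional A" "Fm F \<in> extensional r"
    using F by (auto simp: is_functor_def PiE_def)
qed

lemma mkpsh_collapse: "F \<in> Obj C \<Longrightarrow> mkpsh (Fo F) (res F) = F"
  unfolding mkpsh_def
  using psh_Fo_ext psh_Fm_ext psh_Fm res_ext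
  by (intro ftor.equality) (auto simp: fun_eq_iff extensional_def)

lemma psh_eqI:
  assumes F: "F \<in> Obj C" and G: "G \<in> Obj C"
    and Fo: "\<And>a. a \<in> A \<Longrightarrow> Fo F a = Fo G a"
    and res: "\<And>a b x. (b, a) \<in> r \<Longrightarrow> x \<in> Fo F a \<Longrightarrow> res F b a x = res G b a x"
  shows "F = G"
proof -
  have "mkpsh (Fo F) (res F) = mkpsh (Fo G) (res G)"
    unfolding mkpsh_def using Fo res r_in_A by (auto simp: fun_eq_iff)
  then show ?thesis
    using F G mkpsh_collapse by metis
qed

lemma app_mkarr [simp]: "a \<in> A \<Longrightarrow> x \<in> Fo F a \<Longrightarrow> app (mkarr F \<tau> G) a x = \<tau> a x"
  by (simp add: mkarr_def app_def)

lemma mkarr_hom: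
  assumes "F \<in> Obj C" "G \<in> Obj C"
    and "\<And>a x. a \<in> A \<Longrightarrow> x \<in> Fo F a \<Longrightarrow> \<tau> a x \<in> Fo G a"
    and "\<And>a b x. (b, a) \<in> r \<Longrightarrow> x \<in> Fo F a \<Longrightarrow> \<tau> b (res F b a x) = res G b a (\<tau> a x)"
  shows "mkarr F \<tau> G \<in> hom C F G"
proof -
  have "nat_trans (op_cat (poset_cat A r)) (set_cat U) F G
    (\<lambda>a\<in>A. (Fo F a, \<lambda>x\<in>Fo F a. \<tau> a x, Fo G a))"
    unfolding nat_trans_def Obj_C[symmetric]
    using assms psh_U psh_Fm res_in r_in_A
    by (auto simp: set_cat_hom compose_def fun_eq_iff intro!: restrict_PiE_iff[THEN iffD2]
        bexI[of _ "restrict (\<tau> _) (Fo F _)"])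
  then show ?thesis
    by (simp add: hom_def functor_cat_def mkarr_def)
qed

lemma hom_props:
  assumes "m \<in> hom C F G"
  shows app_in: "a \<in> A \<Longrightarrow> x \<in> Fo F a \<Longrightarrow> app m a x \<in> Fo G a"
    and app_res: "(b, a) \<in> r \<Longrightarrow> x \<in> Fo F a \<Longrightarrow> app m b (res F b a x) = res G b a (app m a x)"
    and mkarr_collapse: "mkarr F (app m) G = m"
    and hom_dom: "F \<in> Obj C" and hom_cod: "G \<in> Obj C"
proof -
  obtain t where t: "m = (F, t, G)" "nat_trans (op_cat (poset_cat A r)) (set_cat U) F G t"
    using assms by (auto simp: hom_def functor_cat_def)
  show FG: "F \<in> Obj C" "G \<in> Obj C"
    using t by (auto simp: nat_trans_def Obj_C)
  have ta: "t a = (Fo F a, app m a, Fo G a) \<and> app m a \<in> Fo F a \<rightarrow>\<^sub>E Fo G a" if "a \<in> A" for a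
  proof -
    have "t a \<in> hom (set_cat U) (Fo F a) (Fo G a)"
      using t(2) that by (auto simp: nat_trans_def)
    then show ?thesis
      using t(1) by (auto simp: set_cat_hom app_def)
  qed
  then show "app m a x \<in> Fo G a" if "a \<in> A" "x \<in> Fo F a" for a x
    using that by blast
  show "app m b (res F b a x) = res G b a (app m a x)" if "(b, a) \<in> r" "x \<in> Fo F a" for a b x
  proof -
    have "Comp (set_cat U) (t b) (Fm F (b, a)) = Comp (set_cat U) (Fm G (b, a)) (t a)"
      using t(2) that by (auto simp: nat_trans_def)
    then have "compose (Fo F a) (app m b) (res F b a) = compose (Fo F a) (res G b a) (app m a)"
      using ta r_in_A that psh_Fm[OF FG(1)] psh_Fm[OF FG(2)] by simp
    from fun_cong[OF this, of x] show ?thesis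
      using that by (simp add: compose_def)
  qed
  have "t \<in> extensional A"
    using t(2) by (simp add: nat_trans_def)
  then show "mkarr F (app m) G = m"
    using ta t(1) unfolding mkarr_def by (fastforce simp: fun_eq_iff extensional_def PiE_def)
qed

lemma arr_eqI:
  assumes "m \<in> hom C F G" "n \<in> hom C F G"
    and "\<And>a x. a \<in> A \<Longrightarrow> x \<in> Fo F a \<Longrightarrow> app m a x = app n a x"
  shows "m = n"
proof -
  have "mkarr F (app m) G = mkarr F (app n) G"
    unfolding mkarr_def using assms(3) by (auto simp: fun_eq_iff)
  then show ?thesis
    using assms mkarr_collapse by metis
qed

lemma app_comp:
  assumes "m \<in> hom C F G" "n \<in> hom C G H" "a \<in> A" "x \<in> Fo F a"
  shows "app (Comp C n m) a x = app n a (app m a x)"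
proof -
  have "Comp C n m = Comp C (mkarr G (app n) H) (mkarr F (app m) G)"
    using mkarr_collapse[OF assms(1)] mkarr_collapse[OF assms(2)] by simp
  then show ?thesis
    using assms app_in[OF assms(1)]
    by (simp add: functor_cat_def mkarr_def app_def compose_def)
qed

lemma app_ident:
  assumes "a \<in> A" "x \<in> Fo F a"
  shows "app (Ident C F) a x = x"
  using assms by (simp add: functor_cat_def app_def)

section \<open>Monomorphisms, strong epimorphisms and isomorphisms in terms of elements\<close>

lemma mono_arr_if_inj:
  assumes m: "m \<in> hom C F G" and inj: "\<And>a. a \<in> A \<Longrightarrow> inj_on (app m a) (Fo F a)"
  shows "mono_arr C m"
proof (rule mono_arrI[OF m])
  fix W g h assume g: "g \<in> hom C W F" and h: "h \<in> hom C W F" and eq: "Comp C m g = Comp C m h"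
  show "g = h"
  proof (rule arr_eqI[OF g h])
    fix a x assume a: "a \<in> A" "x \<in> Fo W a"
    have "app m a (app g a x) = app m a (app h a x)"
      using app_comp[OF g m a] app_comp[OF h m a] eq by simp
    then show "app g a x = app h a x"
      using inj_onD[OF inj[OF a(1)]] app_in[OF g a] app_in[OF h a] by blast
  qed
qed

text \<open>The subterminal presheaf of a down-set \<open>E\<close>; for a principal down-set it is
  representable.\<close>

definition downset_psh :: "'a set \<Rightarrow> ('a, 'u) psh" where
  "downset_psh E = mkpsh (\<lambda>a. if a \<in> E then {undefined} else {}) (\<lambda>b a x. x)"

definition downset :: "'a set \<Rightarrow> bool" where
  "downset E \<longleftrightarrow> E \<subseteq> A \<and> (\<forall>a\<in>E. \<forall>b. (b, a) \<in> r \<longrightarrow> b \<in> E)"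

lemma downset_principal: "a \<in> A \<Longrightarrow> downset {b. (b, a) \<in> r}"
  using r_in_A trans_r by (auto simp: downset_def)

lemma downset_psh_Obj: "downset E \<Longrightarrow> downset_psh E \<in> Obj C"
  unfolding downset_psh_def downset_def
  by (rule mkpsh_Obj) (auto intro: small_in_universe[OF univ] small_finite[OF univ] split: if_splits)

lemma Fo_downset_psh: "a \<in> A \<Longrightarrow> Fo (downset_psh E) a = (if a \<in> E then {undefined} else {})"
  by (simp add: downset_psh_def)

lemma Fo_downset_psh_iff: "a \<in> A \<Longrightarrow> x \<in> Fo (downset_psh E) a \<longleftrightarrow> a \<in> E \<and> x = undefined"
  by (simp add: Fo_downset_psh)

lemma res_downset_psh:
  "(b, a) \<in> r \<Longrightarrow> x \<in> Fo (downset_psh E) a \<Longrightarrow> res (downset_psh E) b a x = x"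
  using r_in_A by (auto simp: downset_psh_def)

text \<open>For the principal down-set of \<open>a\<close> this is the arrow that corresponds to
  \<open>x\<close> under the Yoneda lemma; for a smaller down-set it is the restriction of that
  arrow.\<close>

definition elt_arr :: "'a set \<Rightarrow> 'a \<Rightarrow> ('a, 'u) psh \<Rightarrow> 'u \<Rightarrow> ('a, 'u) psh_arr" where
  "elt_arr E a F x = mkarr (downset_psh E) (\<lambda>b _. res F b a x) F"

lemma elt_arr_hom:
  assumes F: "F \<in> Obj C" and E: "downset E" and Ea: "E \<subseteq> {b. (b, a) \<in> r}" and x: "x \<in> Fo F a"
  shows "elt_arr E a F x \<in> hom C (downset_psh E) F"
  unfolding elt_arr_def
proof (rule mkarr_hom[OF downset_psh_Obj[OF E] F])
  show "res F b a x \<in> Fo F b" if "b \<in> A" "y \<in> Fo (downset_psh E) b" for b y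
    using that Ea x res_in[OF F] by (auto simp: Fo_downset_psh_iff)
  show "res F c a x = res F c b (res F b a x)"
    if "(c, b) \<in> r" "y \<in> Fo (downset_psh E) b" for b c y
    using that Ea x res_res[OF F, of b a c] r_in_A by (auto simp: Fo_downset_psh_iff)
qed

lemma app_elt_arr:
  "b \<in> A \<Longrightarrow> b \<in> E \<Longrightarrow> app (elt_arr E a F x) b undefined = res F b a x"
  by (simp add: elt_arr_def Fo_downset_psh)

text \<open>Elements of \<open>F\<close> at \<open>a\<close> are arrows from the representable at
  \<open>a\<close>. Two elements with equal image give arrows that \<open>m\<close> cannot tell
  apart, so these arrows agree, and evaluating them at \<open>a\<close> returns the
  elements.\<close>

lemma inj_if_mono_arr:
  assumes m: "m \<in> hom C F G" and mono: "mono_arr C m" and a: "a \<in> A"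
  shows "inj_on (app m a) (Fo F a)"
proof (rule inj_onI)
  fix x y assume x: "x \<in> Fo F a" and y: "y \<in> Fo F a" and eq: "app m a x = app m a y"
  let ?E = "{b. (b, a) \<in> r}"
  note F = hom_dom[OF m]
  have h: "elt_arr ?E a F z \<in> hom C (downset_psh ?E) F" if "z \<in> Fo F a" for z
    using elt_arr_hom[OF F downset_principal[OF a] _ that] by blast
  have "Comp C m (elt_arr ?E a F x) = Comp C m (elt_arr ?E a F y)"
  proof (rule arr_eqI)
    fix b z assume b: "b \<in> A" "z \<in> Fo (downset_psh ?E) b"
    then have "(b, a) \<in> r" "z = undefined"
      by (auto simp: Fo_downset_psh_iff)
    then show "app (Comp C m (elt_arr ?E a F x)) b z = app (Comp C m (elt_arr ?E a F y)) b z"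
      using app_comp[OF h[OF x] m b] app_comp[OF h[OF y] m b] b app_res[OF m, of b a] x y eq
      by (simp add: app_elt_arr)
  qed (use comp_hom[OF category_C h m] x y in auto)
  then have "elt_arr ?E a F x = elt_arr ?E a F y"
    using mono_arrD[OF mono m category_C h[OF x] h[OF y]] by blast
  then have "res F a a x = res F a a y"
    using app_elt_arr[OF a, of ?E a F] refl_r[OF a] by (metis mem_Collect_eq)
  then show "x = y"
    using res_id[OF F a] x y by simp
qed

definition image_psh :: "('a, 'u) psh \<Rightarrow> ('a, 'u) psh \<Rightarrow> ('a, 'u) psh_arr \<Rightarrow> ('a, 'u) psh" where
  "image_psh F G m = mkpsh (\<lambda>a. app m a ` Fo F a) (res G)"

text \<open>Factor \<open>e\<close> through its pointwise image and fill the square whose lower side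
  is the identity of \<open>G\<close>. The diagonal is a section of the inclusion of the image, so
  the image is all of \<open>G\<close>.\<close>

lemma surj_if_strong_epi_arr:
  assumes e: "e \<in> hom C F G" and se: "strong_epi_arr C e" and a: "a \<in> A"
  shows "app e a ` Fo F a = Fo G a"
proof
  show sub: "app e a ` Fo F a \<subseteq> Fo G a"
    using app_in[OF e a] by blast
  note F = hom_dom[OF e] and G = hom_cod[OF e]
  let ?M = "image_psh F G e"
  have FoM: "Fo ?M a = app e a ` Fo F a" if "a \<in> A" for a
    using that by (simp add: image_psh_def)
  have FoMG: "x \<in> Fo G a" if "a \<in> A" "x \<in> Fo ?M a" for a x
    using that FoM app_in[OF e] by auto
  have M: "?M \<in> Obj C"
    unfolding image_psh_def
  proof (rule mkpsh_Obj)
    show "app e a ` Fo F a \<in> U" if "a \<in> A" for a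
      by (rule small_in_universe[OF univ small_image[OF universe_small[OF psh_U[OF F that]]]])
    show "res G b a x \<in> app e b ` Fo F b" if "(b, a) \<in> r" "x \<in> app e a ` Fo F a" for a b x
      using that app_res[OF e, symmetric] res_in[OF F] by auto
    show "res G c b (res G b a x) = res G c a x"
      if "(b, a) \<in> r" "(c, b) \<in> r" "x \<in> app e a ` Fo F a" for a b c x
      using that res_res[OF G] app_in[OF e] r_in_A by blast
  qed (use app_in[OF e] res_id[OF G] in auto)
  have resM: "res ?M b a x = res G b a x" if "(b, a) \<in> r" "x \<in> Fo ?M a" for a b x
    using that FoM r_in_A by (simp add: image_psh_def)
  let ?m = "mkarr ?M (\<lambda>a x. x) G" and ?u = "mkarr F (app e) ?M"
  have m: "?m \<in> hom C ?M G"
    by (rule mkarr_hom[OF M G]) (use FoMG resM in auto)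
  have u: "?u \<in> hom C F ?M"
  proof (rule mkarr_hom[OF F M])
    show "app e b (res F b a x) = res ?M b a (app e a x)" if "(b, a) \<in> r" "x \<in> Fo F a" for a b x
      using that resM[of b a "app e a x"] FoM r_in_A app_res[OF e] by simp
  qed (simp add: FoM)
  have mono: "mono_arr C ?m"
    by (rule mono_arr_if_inj[OF m]) (auto intro!: inj_onI)
  have "Comp C ?m ?u = Comp C (Ident C G) e"
  proof (rule arr_eqI[OF comp_hom[OF category_C u m]])
    show "Comp C (Ident C G) e \<in> hom C F G"
      using ident_comp[OF category_C e] e by simp
    show "app (Comp C ?m ?u) a x = app (Comp C (Ident C G) e) a x" if "a \<in> A" "x \<in> Fo F a" for a x
      using app_comp[OF u m that] that FoM ident_comp[OF category_C e] by simp
  qed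
  then obtain d where d: "d \<in> hom C G ?M" "Comp C ?m d = Ident C G"
    using se mono u ident_hom[OF category_C G] homD[OF e] homD[OF m]
    unfolding strong_epi_arr_def by metis
  show "Fo G a \<subseteq> app e a ` Fo F a"
  proof
    fix y assume y: "y \<in> Fo G a"
    have "app d a y = y"
      using app_comp[OF d(1) m a y] app_in[OF d(1) a y] d(2) a y by (simp add: app_ident)
    then show "y \<in> app e a ` Fo F a"
      using app_in[OF d(1) a y] FoM[OF a] by simp
  qed
qed

lemma iso_arr_if_bij:
  assumes m: "m \<in> hom C F G" and bij: "\<And>a. a \<in> A \<Longrightarrow> bij_betw (app m a) (Fo F a) (Fo G a)"
  shows "iso_arr C m"
proof -
  note F = hom_dom[OF m] and G = hom_cod[OF m]
  define \<tau> where "\<tau> a = inv_into (Fo F a) (app m a)" for a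
  have \<tau>in: "\<tau> a y \<in> Fo F a" and m\<tau>: "app m a (\<tau> a y) = y" if "a \<in> A" "y \<in> Fo G a" for a y
    using that bij[OF that(1)] unfolding \<tau>_def bij_betw_def
    by (metis inv_into_into, metis f_inv_into_f)
  have \<tau>m: "\<tau> a (app m a x) = x" if "a \<in> A" "x \<in> Fo F a" for a x
    using that bij[OF that(1)] unfolding \<tau>_def bij_betw_def by simp
  let ?n = "mkarr G \<tau> F"
  have n: "?n \<in> hom C G F"
  proof (rule mkarr_hom[OF G F \<tau>in])
    fix a b y assume ab: "(b, a) \<in> r" and y: "y \<in> Fo G a"
    have "app m b (res F b a (\<tau> a y)) = res G b a y"
      using app_res[OF m ab \<tau>in] m\<tau> y r_in_A[OF ab] by simp
    then show "\<tau> b (res G b a y) = res F b a (\<tau> a y)"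
      using \<tau>m res_in[OF F ab \<tau>in] y r_in_A[OF ab] by metis
  qed
  have "Comp C ?n m = Ident C F"
    by (rule arr_eqI[OF comp_hom[OF category_C m n] ident_hom[OF category_C F]])
      (simp add: app_comp[OF m n] app_ident app_in[OF m] \<tau>m)
  moreover have "Comp C m ?n = Ident C G"
    by (rule arr_eqI[OF comp_hom[OF category_C n m] ident_hom[OF category_C G]])
      (simp add: app_comp[OF n m] app_ident m\<tau>)
  ultimately show ?thesis
    using m n homD[OF m] unfolding iso_arr_def by metis
qed


section \<open>Colimits of presheaves are computed pointwise\<close>

text \<open>A pair \<open>(j, x)\<close> is a point of the disjoint union of the fibres over
  \<open>a\<close>. The colimit at \<open>a\<close> is the quotient of that union by the equivalence
  which these steps generate.\<close>

definition colim_step where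
  "colim_step J D a = {((j, x), (k, y)). \<exists>f\<in>Arr J. Dom J f = j \<and> Cod J f = k \<and>
     x \<in> Fo (Fo D j) a \<and> y = app (Fm D f) a x}"

definition colim_eq where
  "colim_eq J D a = (colim_step J D a \<union> (colim_step J D a)\<inverse>)\<^sup>*"

text \<open>The legs are jointly surjective and identify no more than zigzags force; that they
  identify at least this much holds for every cocone by \<open>colim_eq_cocone\<close>. So each
  fibre of \<open>V\<close> is the quotient up to bijection.\<close>

definition pointwise_colimit where
  "pointwise_colimit J D V c \<longleftrightarrow> cocone J C D V c \<and>
     (\<forall>a\<in>A. \<forall>v\<in>Fo V a. \<exists>j\<in>Obj J. \<exists>x\<in>Fo (Fo D j) a. v = app (c j) a x) \<and>
     (\<forall>a\<in>A. \<forall>j\<in>Obj J. \<forall>k\<in>Obj J. \<forall>x\<in>Fo (Fo D j) a. \<forall>y\<in>Fo (Fo D k) a.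
        app (c j) a x = app (c k) a y \<longrightarrow> ((j, x), (k, y)) \<in> colim_eq J D a)"

lemma colim_eq_refl: "(p, p) \<in> colim_eq J D a"
  by (simp add: colim_eq_def)

lemma colim_eq_sym: "(p, q) \<in> colim_eq J D a \<Longrightarrow> (q, p) \<in> colim_eq J D a"
  unfolding colim_eq_def by (rule symD[OF sym_rtrancl]) (auto simp: sym_def)

lemma colim_eq_trans:
  "(p, q) \<in> colim_eq J D a \<Longrightarrow> (q, s) \<in> colim_eq J D a \<Longrightarrow> (p, s) \<in> colim_eq J D a"
  by (simp add: colim_eq_def)

lemma colim_step_in_eq: "(p, q) \<in> colim_step J D a \<Longrightarrow> (p, q) \<in> colim_eq J D a"
  unfolding colim_eq_def by blast

lemma colim_stepD:
  assumes J: "category J" and D: "is_functor J C D" and a: "a \<in> A"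
    and st: "((j, x), (k, y)) \<in> colim_step J D a"
  obtains f where "f \<in> Arr J" "Dom J f = j" "Cod J f = k" "y = app (Fm D f) a x"
    "Fm D f \<in> hom C (Fo D j) (Fo D k)" "j \<in> Obj J" "k \<in> Obj J"
    "x \<in> Fo (Fo D j) a" "y \<in> Fo (Fo D k) a"
proof -
  obtain f where f: "f \<in> Arr J" "Dom J f = j" "Cod J f = k" "x \<in> Fo (Fo D j) a"
    "y = app (Fm D f) a x"
    using st by (auto simp: colim_step_def)
  moreover have "Fm D f \<in> hom C (Fo D j) (Fo D k)"
    using is_functor_hom[OF D f(1)] f by simp
  moreover have "j \<in> Obj J" "k \<in> Obj J"
    using J f by (auto simp: category_def)
  ultimately show thesis
    using that app_in a by blast
qed

text \<open>Induction along a zigzag, whose steps may point either way. As \<open>colim_eq\<close>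
  is reflexive on all pairs, membership in the fibres is carried along from the starting
  pair.\<close>

lemma colim_eq_induct [consumes 6, case_names refl forward backward]:
  assumes J: "category J" and D: "is_functor J C D" and a: "a \<in> A"
    and j: "j \<in> Obj J" and x: "x \<in> Fo (Fo D j) a"
    and eq: "((j, x), (k, y)) \<in> colim_eq J D a"
    and refl: "P j x"
    and forward: "\<And>k y f l. P k y \<Longrightarrow> k \<in> Obj J \<Longrightarrow> y \<in> Fo (Fo D k) a \<Longrightarrow> f \<in> Arr J \<Longrightarrow>
      Dom J f = k \<Longrightarrow> Cod J f = l \<Longrightarrow> Fm D f \<in> hom C (Fo D k) (Fo D l) \<Longrightarrow> l \<in> Obj J \<Longrightarrow>
      P l (app (Fm D f) a y)"
    and backward: "\<And>k y f l. P k (app (Fm D f) a y) \<Longrightarrow> k \<in> Obj J \<Longrightarrow>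
      y \<in> Fo (Fo D l) a \<Longrightarrow> f \<in> Arr J \<Longrightarrow>
      Dom J f = l \<Longrightarrow> Cod J f = k \<Longrightarrow> Fm D f \<in> hom C (Fo D l) (Fo D k) \<Longrightarrow> l \<in> Obj J \<Longrightarrow>
      P l y"
  shows "P k y \<and> k \<in> Obj J \<and> y \<in> Fo (Fo D k) a"
proof -
  have "((j, x), (k, y)) \<in> (colim_step J D a \<union> (colim_step J D a)\<inverse>)\<^sup>*"
    using eq by (simp add: colim_eq_def)
  then show ?thesis
  proof (induction rule: rtrancl_induct2)
    case refl
    then show ?case
      using j x assms(7) by blast
  next
    case (step k y l z)
    from step.hyps(2) show ?case
    proof
      assume "((k, y), (l, z)) \<in> colim_step J D a"
      from colim_stepD[OF J D a this] show ?thesis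
        using step.IH forward by metis
    next
      assume "((k, y), (l, z)) \<in> (colim_step J D a)\<inverse>"
      then have "((l, z), (k, y)) \<in> colim_step J D a"
        by simp
      from colim_stepD[OF J D a this] show ?thesis
        using step.IH backward by metis
    qed
  qed
qed

lemma colim_eq_cocone:
  assumes J: "category J" and D: "is_functor J C D" and a: "a \<in> A"
    and j: "j \<in> Obj J" and x: "x \<in> Fo (Fo D j) a"
    and eq: "((j, x), (k, y)) \<in> colim_eq J D a" and c: "cocone J C D V c"
  shows "app (c k) a y = app (c j) a x"
proof -
  have cf: "app (c l) a (app (Fm D f) a z) = app (c i) a z"
    if "f \<in> Arr J" "Dom J f = i" "Cod J f = l" "Fm D f \<in> hom C (Fo D i) (Fo D l)"
      "l \<in> Obj J" "z \<in> Fo (Fo D i) a" for f i l z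
    using app_comp[OF that(4) cocone_hom[OF c that(5)] a that(6)] cocone_comp[OF c that(1)] that
    by simp
  have "app (c k) a y = app (c j) a x \<and> k \<in> Obj J \<and> y \<in> Fo (Fo D k) a"
    using J D a j x eq
  proof (induction rule: colim_eq_induct)
    case (forward k y f l)
    show ?case
      using cf[OF forward(4-8,3)] forward(1) by (rule trans)
  next
    case (backward k y f l)
    show ?case
      using cf[OF backward(4-7,2,3)] backward(1) by (rule trans[OF sym])
  qed (rule HOL.refl)
  then show ?thesis ..
qed

text \<open>Transition maps commute with restriction, so each step over \<open>a\<close> restricts
  to a step over \<open>b\<close>. This makes restriction well defined on the quotients.\<close>

lemma colim_eq_res:
  assumes J: "category J" and D: "is_functor J C D" and ba: "(b, a) \<in> r"
    and j: "j \<in> Obj J" and x: "x \<in> Fo (Fo D j) a"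
    and eq: "((j, x), (k, y)) \<in> colim_eq J D a"
  shows "((j, res (Fo D j) b a x), (k, res (Fo D k) b a y)) \<in> colim_eq J D b"
proof -
  have step: "((k, res (Fo D k) b a y), (l, res (Fo D l) b a (app (Fm D f) a y))) \<in> colim_eq J D b"
    if "f \<in> Arr J" "Dom J f = k" "Cod J f = l" "Fm D f \<in> hom C (Fo D k) (Fo D l)"
      "y \<in> Fo (Fo D k) a" for f k l y
    using that res_in[OF hom_dom[OF that(4)] ba that(5)] app_res[OF that(4) ba that(5)]
    by (intro colim_step_in_eq) (auto simp: colim_step_def)
  have "((j, res (Fo D j) b a x), (k, res (Fo D k) b a y)) \<in> colim_eq J D b \<and>
      k \<in> Obj J \<and> y \<in> Fo (Fo D k) a"
    using J D r_in_A(2)[OF ba] j x eq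
  proof (induction rule: colim_eq_induct)
    case (forward k y f l)
    show ?case
      by (rule colim_eq_trans[OF forward(1) step[OF forward(4-7,3)]])
  next
    case (backward k y f l)
    show ?case
      by (rule colim_eq_trans[OF backward(1) colim_eq_sym[OF step[OF backward(4-7,3)]]])
  qed (rule colim_eq_refl)
  then show ?thesis ..
qed

text \<open>The induced arrow sends the image of \<open>x\<close> under a leg of \<open>c\<close> to
  its image under the leg of \<open>w\<close>. This is consistent because identifications made by
  \<open>c\<close> come from zigzags, and every cocone respects zigzags.\<close>

lemma pointwise_colimit_is_colimit:
  assumes J: "category J" and D: "is_functor J C D" and pc: "pointwise_colimit J D V c"
  shows "is_colimit J C D V c"
  unfolding is_colimit_def
proof (intro conjI allI impI)
  have c: "cocone J C D V c"
    and surj: "\<And>a v. a \<in> A \<Longrightarrow> v \<in> Fo V a \<Longrightarrow> \<exists>j\<in>Obj J. \<exists>x\<in>Fo (Fo D j) a. v = app (c j) a x"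
    and eq: "\<And>a j k x y. a \<in> A \<Longrightarrow> j \<in> Obj J \<Longrightarrow> k \<in> Obj J \<Longrightarrow> x \<in> Fo (Fo D j) a \<Longrightarrow>
      y \<in> Fo (Fo D k) a \<Longrightarrow> app (c j) a x = app (c k) a y \<Longrightarrow> ((j, x), (k, y)) \<in> colim_eq J D a"
    using pc unfolding pointwise_colimit_def by blast+
  show "cocone J C D V c"
    by (rule c)
  have V: "V \<in> Obj C"
    using c by (simp add: cocone_def)
  fix W w assume w: "cocone J C D W w"
  then have W: "W \<in> Obj C"
    by (simp add: cocone_def)
  define P where "P a v j x \<longleftrightarrow> j \<in> Obj J \<and> x \<in> Fo (Fo D j) a \<and> v = app (c j) a x" for a v j x
  define \<eta> where "\<eta> a v = (SOME z. \<exists>j x. P a v j x \<and> z = app (w j) a x)" for a v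
  have \<eta>: "\<eta> a (app (c j) a x) = app (w j) a x"
    if "a \<in> A" "j \<in> Obj J" "x \<in> Fo (Fo D j) a" for a j x
  proof -
    have "\<exists>k y. P a (app (c j) a x) k y \<and> \<eta> a (app (c j) a x) = app (w k) a y"
      unfolding \<eta>_def by (rule someI_ex) (use that P_def in blast)
    then obtain k y where ky: "k \<in> Obj J" "y \<in> Fo (Fo D k) a" "app (c j) a x = app (c k) a y"
      "\<eta> a (app (c j) a x) = app (w k) a y"
      unfolding P_def by blast
    then show ?thesis
      using colim_eq_cocone[OF J D that eq[OF that(1,2) ky(1) that(3) ky(2,3)] w] by simp
  qed
  let ?h = "mkarr V \<eta> W"
  have h: "?h \<in> hom C V W"
  proof (rule mkarr_hom[OF V W])
    show "\<eta> a v \<in> Fo W a" if "a \<in> A" "v \<in> Fo V a" for a v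
      using surj[OF that] \<eta>[OF that(1)] app_in[OF cocone_hom[OF w] that(1)] by auto
    fix a b v assume ba: "(b, a) \<in> r" and v: "v \<in> Fo V a"
    note A = r_in_A[OF ba]
    obtain j x where jx: "j \<in> Obj J" "x \<in> Fo (Fo D j) a" "v = app (c j) a x"
      using surj[OF A(2) v] by blast
    have "\<eta> b (res V b a v) = \<eta> b (app (c j) b (res (Fo D j) b a x))"
      using app_res[OF cocone_hom[OF c jx(1)] ba jx(2)] jx(3) by simp
    also have "\<dots> = app (w j) b (res (Fo D j) b a x)"
      using \<eta>[OF A(1) jx(1)] res_in[OF is_functor_Obj[OF D jx(1)] ba jx(2)] by simp
    also have "\<dots> = res W b a (\<eta> a v)"
      using app_res[OF cocone_hom[OF w jx(1)] ba jx(2)] \<eta>[OF A(2) jx(1,2)] jx(3) by simp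
    finally show "\<eta> b (res V b a v) = res W b a (\<eta> a v)" .
  qed
  have "Comp C ?h (c j) = w j" if j: "j \<in> Obj J" for j
  proof (rule arr_eqI[OF comp_hom[OF category_C cocone_hom[OF c j] h] cocone_hom[OF w j]])
    show "app (Comp C ?h (c j)) a x = app (w j) a x" if "a \<in> A" "x \<in> Fo (Fo D j) a" for a x
      using app_comp[OF cocone_hom[OF c j] h that] app_in[OF cocone_hom[OF c j] that]
        \<eta>[OF that(1) j that(2)] that by simp
  qed
  moreover have "g = ?h" if g: "g \<in> hom C V W" "\<forall>j\<in>Obj J. Comp C g (c j) = w j" for g
  proof (rule arr_eqI[OF g(1) h])
    fix a v assume av: "a \<in> A" "v \<in> Fo V a"
    obtain j x where jx: "j \<in> Obj J" "x \<in> Fo (Fo D j) a" "v = app (c j) a x"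
      using surj[OF av] by blast
    then show "app g a v = app ?h a v"
      using app_comp[OF cocone_hom[OF c jx(1)] g(1) av(1) jx(2)] g(2) \<eta>[OF av(1) jx(1,2)] av by simp
  qed
  ultimately show "\<exists>!h. h \<in> hom C V W \<and> (\<forall>j\<in>Obj J. Comp C h (c j) = w j)"
    using h by blast
qed

text \<open>Equivalence classes have the wrong type: fibres must be members of \<open>U\<close>,
  hence sets over \<open>'u\<close>. A class is therefore named by the code in \<open>'u\<close> of
  one chosen representative. Smallness of the object set bounds the disjoint union of the fibres, so
  such codes exist.\<close>

lemma pointwise_colimit_exists:
  fixes J :: "('j, 'k) cat"
  assumes J: "category J" and D: "is_functor J C D" and small: "small U (Obj J)"
  obtains V c where "pointwise_colimit J D V c"
proof -
  define G where "G a = (SIGMA j:Obj J. Fo (Fo D j) a)" for a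
  have G_iff: "(j, x) \<in> G a \<longleftrightarrow> j \<in> Obj J \<and> x \<in> Fo (Fo D j) a" for j x a
    by (simp add: G_def)
  have DO: "Fo D j \<in> Obj C" if "j \<in> Obj J" for j
    using is_functor_Obj[OF D that] .
  have "\<exists>q :: 'j \<times> 'u \<Rightarrow> 'u. q ` G a \<in> U \<and>
      (\<forall>z\<in>G a. \<forall>z'\<in>G a. q z = q z' \<longleftrightarrow> (z, z') \<in> colim_eq J D a)" if a: "a \<in> A" for a
  proof -
    have "small U (G a)"
      unfolding G_def by (rule small_Sigma[OF univ small psh_U[OF DO a]])
    then obtain g :: "'j \<times> 'u \<Rightarrow> 'u" where g: "inj_on g (G a)" "g ` G a \<in> U"
      using small_encoding[OF univ] by blast
    \<comment> \<open>Equivalent points have the same candidates, so the choice operator returns the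
      same representative for both.\<close>
    define \<epsilon> where "\<epsilon> z = (SOME z'. z' \<in> G a \<and> (z, z') \<in> colim_eq J D a)" for z
    have \<epsilon>: "\<epsilon> z \<in> G a \<and> (z, \<epsilon> z) \<in> colim_eq J D a" if "z \<in> G a" for z
      unfolding \<epsilon>_def by (rule someI[of _ z]) (simp add: that colim_eq_refl)
    have \<epsilon>eq: "\<epsilon> z = \<epsilon> z'" if "(z, z') \<in> colim_eq J D a" for z z'
    proof -
      have "(z, y) \<in> colim_eq J D a \<longleftrightarrow> (z', y) \<in> colim_eq J D a" for y
        using that colim_eq_trans colim_eq_sym by metis
      then show ?thesis
        by (simp add: \<epsilon>_def)
    qed
    have "(\<lambda>z. g (\<epsilon> z)) ` G a \<subseteq> g ` G a"
      using \<epsilon> by auto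
    then have "(\<lambda>z. g (\<epsilon> z)) ` G a \<in> U"
      by (rule small_in_universe[OF univ small_subset[OF _ universe_small[OF g(2)]]])
    moreover have "g (\<epsilon> z) = g (\<epsilon> z') \<longleftrightarrow> (z, z') \<in> colim_eq J D a" if "z \<in> G a" "z' \<in> G a" for z z'
      using that \<epsilon> \<epsilon>eq inj_onD[OF g(1)] colim_eq_trans colim_eq_sym by metis
    ultimately show ?thesis
      by blast
  qed
  then obtain q :: "'a \<Rightarrow> 'j \<times> 'u \<Rightarrow> 'u" where qU: "\<And>a. a \<in> A \<Longrightarrow> q a ` G a \<in> U"
    and q: "\<And>a z z'. a \<in> A \<Longrightarrow> z \<in> G a \<Longrightarrow> z' \<in> G a \<Longrightarrow>
      q a z = q a z' \<longleftrightarrow> (z, z') \<in> colim_eq J D a"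
    by metis
  \<comment> \<open>A class is restricted through whichever representative \<open>inv_into\<close>
    returns; \<open>colim_eq_res\<close> then gives the same rule for every representative.\<close>
  define \<rho> where "\<rho> b a v = (let (j, x) = inv_into (G a) (q a) v in q b (j, res (Fo D j) b a x))"
    for b a v
  have Gres: "(j, res (Fo D j) b a x) \<in> G b" if "(j, x) \<in> G a" "(b, a) \<in> r" for j x a b
    using that res_in[OF DO] by (simp add: G_iff)
  have \<rho>: "\<rho> b a (q a (j, x)) = q b (j, res (Fo D j) b a x)"
    if ba: "(b, a) \<in> r" and jx: "(j, x) \<in> G a" for a b j x
  proof -
    note A = r_in_A[OF ba]
    obtain k y where ky: "inv_into (G a) (q a) (q a (j, x)) = (k, y)"
      by fastforce
    then have kyG: "(k, y) \<in> G a" and "q a (k, y) = q a (j, x)"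
      using inv_into_into[of "q a (j, x)" "q a" "G a"] f_inv_into_f[of "q a (j, x)" "q a" "G a"] jx
      by auto
    then have "((k, y), (j, x)) \<in> colim_eq J D a"
      using q[OF A(2) kyG jx] by simp
    then have "((k, res (Fo D k) b a y), (j, res (Fo D j) b a x)) \<in> colim_eq J D b"
      using colim_eq_res[OF J D ba] kyG by (simp add: G_iff)
    then have "q b (k, res (Fo D k) b a y) = q b (j, res (Fo D j) b a x)"
      using q[OF A(1) Gres[OF kyG ba] Gres[OF jx ba]] by simp
    then show ?thesis
      by (simp add: \<rho>_def ky)
  qed
  define V where "V = mkpsh (\<lambda>a. q a ` G a) \<rho>"
  have FoV: "Fo V a = q a ` G a" if "a \<in> A" for a
    using that by (simp add: V_def)
  have V: "V \<in> Obj C"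
    unfolding V_def
  proof (rule mkpsh_Obj[OF qU])
    show "\<rho> b a v \<in> q b ` G b" if "(b, a) \<in> r" "v \<in> q a ` G a" for a b v
      using that \<rho> Gres by fastforce
    show "\<rho> a a v = v" if a: "a \<in> A" and v: "v \<in> q a ` G a" for a v
      using v \<rho>[OF refl_r[OF a]] res_id[OF DO a] by (auto simp: G_iff)
    show "\<rho> c b (\<rho> b a v) = \<rho> c a v"
      if ba: "(b, a) \<in> r" and cb: "(c, b) \<in> r" and v: "v \<in> q a ` G a" for a b c v
    proof -
      obtain j x where jx: "(j, x) \<in> G a" "v = q a (j, x)"
        using v by auto
      then show ?thesis
        using \<rho>[OF ba jx(1)] \<rho>[OF cb Gres[OF jx(1) ba]] \<rho>[OF trans_r[OF cb ba] jx(1)]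
          res_res[OF DO ba cb] by (simp add: G_iff)
    qed
  qed
  have resV: "res V b a (q a (j, x)) = q b (j, res (Fo D j) b a x)"
    if ba: "(b, a) \<in> r" and jx: "(j, x) \<in> G a" for a b j x
    using \<rho>[OF that] jx ba by (simp add: V_def)
  define c where "c j = mkarr (Fo D j) (\<lambda>a x. q a (j, x)) V" for j
  have c: "c j \<in> hom C (Fo D j) V" if j: "j \<in> Obj J" for j
    unfolding c_def
    by (rule mkarr_hom[OF DO[OF j] V]) (use j FoV resV in \<open>auto simp: G_iff\<close>)
  have appc: "app (c j) a x = q a (j, x)" if "a \<in> A" "x \<in> Fo (Fo D j) a" for a j x
    using that by (simp add: c_def)
  have "Comp C (c (Cod J f)) (Fm D f) = c (Dom J f)" if f: "f \<in> Arr J" for f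
  proof -
    note Df = is_functor_hom[OF D f]
    have ob: "Dom J f \<in> Obj J" "Cod J f \<in> Obj J"
      using J f by (auto simp: category_def)
    show ?thesis
    proof (rule arr_eqI[OF comp_hom[OF category_C Df c[OF ob(2)]] c[OF ob(1)]])
      fix a x assume a: "a \<in> A" and x: "x \<in> Fo (Fo D (Dom J f)) a"
      have "((Cod J f, app (Fm D f) a x), (Dom J f, x)) \<in> colim_eq J D a"
        using f x by (intro colim_eq_sym[OF colim_step_in_eq]) (auto simp: colim_step_def)
      then show "app (Comp C (c (Cod J f)) (Fm D f)) a x = app (c (Dom J f)) a x"
        using app_comp[OF Df c[OF ob(2)] a x] appc a x app_in[OF Df a x] q[OF a] ob
        by (simp add: G_iff)
    qed
  qed
  then have "cocone J C D V c"
    using V c by (simp add: cocone_def)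
  moreover have "\<exists>j\<in>Obj J. \<exists>x\<in>Fo (Fo D j) a. v = app (c j) a x" if "a \<in> A" "v \<in> Fo V a" for a v
    using that FoV appc by (auto simp: G_def)
  ultimately have "pointwise_colimit J D V c"
    unfolding pointwise_colimit_def using appc q by (simp add: G_iff)
  then show thesis
    by (rule that)
qed

lemma cocomplete_C: "cocomplete U C"
  unfolding cocomplete_def
  using pointwise_colimit_exists pointwise_colimit_is_colimit universe_small by metis

text \<open>Compare with the constructed colimit: the arrow to it has a left inverse. An element of
  \<open>V\<close> is lifted to a stage there and brought back, and an identification made by
  \<open>c\<close> is also made by \<open>c'\<close>, where it comes from a zigzag.\<close>

lemma colimit_is_pointwise:
  assumes J: "category J" and D: "is_functor J C D" and small: "small U (Obj J)"
    and c: "is_colimit J C D V c"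
  shows "pointwise_colimit J D V c"
proof -
  obtain V' c' where pc: "pointwise_colimit J D V' c'"
    using pointwise_colimit_exists[OF J D small] .
  note cc = is_colimit_cocone[OF c]
  have cc': "cocone J C D V' c'"
    using pc by (simp add: pointwise_colimit_def)
  obtain h k where h: "h \<in> hom C V V'" "\<And>j. j \<in> Obj J \<Longrightarrow> Comp C h (c j) = c' j"
    and k: "k \<in> hom C V' V" "\<And>j. j \<in> Obj J \<Longrightarrow> Comp C k (c' j) = c j"
    and kh: "Comp C k h = Ident C V"
    using colimit_comparison_inverse[OF category_C J D c pointwise_colimit_is_colimit[OF J D pc]]
    by metis
  show ?thesis
    unfolding pointwise_colimit_def
  proof (intro conjI ballI impI cc)
    fix a v assume a: "a \<in> A" and v: "v \<in> Fo V a"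
    obtain j x where jx: "j \<in> Obj J" "x \<in> Fo (Fo D j) a" "app h a v = app (c' j) a x"
      using pc app_in[OF h(1) a v] a unfolding pointwise_colimit_def by blast
    have "v = app k a (app h a v)"
      using app_comp[OF h(1) k(1) a v] kh app_ident[OF a v] by simp
    then have "v = app (c j) a x"
      using jx app_comp[OF cocone_hom[OF cc' jx(1)] k(1) a jx(2)] k(2) by simp
    then show "\<exists>j\<in>Obj J. \<exists>x\<in>Fo (Fo D j) a. v = app (c j) a x"
      using jx by blast
  next
    fix a i j x y
    assume a: "a \<in> A" and ij: "i \<in> Obj J" "j \<in> Obj J" and xy: "x \<in> Fo (Fo D i) a" "y \<in> Fo (Fo D j) a"
      and eq: "app (c i) a x = app (c j) a y"
    have "app (c' i) a x = app (c' j) a y"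
      using app_comp[OF cocone_hom[OF cc ij(1)] h(1) a xy(1)] h(2)[OF ij(1)]
        app_comp[OF cocone_hom[OF cc ij(2)] h(1) a xy(2)] h(2)[OF ij(2)] eq by simp
    then show "((i, x), (j, y)) \<in> colim_eq J D a"
      using pc a ij xy unfolding pointwise_colimit_def by blast
  qed
qed

end


section \<open>Finite presheaves and directed unions\<close>

lemma directed_poset_in:
  "directed_poset I le \<Longrightarrow> (i, j) \<in> le \<Longrightarrow> i \<in> I \<and> j \<in> I"
  by (auto simp: directed_poset_def partial_order_on_def preorder_on_def)

lemma directed_poset_refl: "directed_poset I le \<Longrightarrow> i \<in> I \<Longrightarrow> (i, i) \<in> le"
  by (auto simp: directed_poset_def partial_order_on_def preorder_on_def refl_on_def)

lemma directed_poset_trans: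
  "directed_poset I le \<Longrightarrow> (i, j) \<in> le \<Longrightarrow> (j, k) \<in> le \<Longrightarrow> (i, k) \<in> le"
  by (auto simp: directed_poset_def partial_order_on_def preorder_on_def dest: transD)

lemma directed_poset_ub:
  assumes "directed_poset I le" "i \<in> I" "j \<in> I"
  obtains k where "(i, k) \<in> le" "(j, k) \<in> le"
  using assms by (auto simp: directed_poset_def)

lemma directed_poset_finite_ub:
  assumes I: "directed_poset I le" and "finite S" "S \<subseteq> I"
  obtains u where "u \<in> I" "\<And>i. i \<in> S \<Longrightarrow> (i, u) \<in> le"
proof -
  have "\<exists>u\<in>I. \<forall>i\<in>S. (i, u) \<in> le"
    using assms(2,3)
  proof (induction S)
    case empty
    then show ?case
      using I by (auto simp: directed_poset_def)
  next
    case (insert i S)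
    then obtain u where u: "u \<in> I" "\<forall>i\<in>S. (i, u) \<in> le"
      by auto
    obtain v where v: "(i, v) \<in> le" "(u, v) \<in> le"
      using directed_poset_ub[OF I, of i u] insert.prems u by auto
    have "v \<in> I"
      using directed_poset_in[OF I v(1)] by simp
    then show ?case
      using u(2) v directed_poset_trans[OF I] by blast
  qed
  then show thesis
    using that by blast
qed

lemma directed_poset_category: "directed_poset I le \<Longrightarrow> category (poset_cat I le)"
  by (rule category_poset_cat) (simp add: directed_poset_def)

text \<open>Diagrams are indexed by elements of the type underlying the universe, so a small directed
  family of sets has to be encoded.\<close>

lemma directed_encoding:
  fixes U :: "'u set set" and \<E> :: "'b set set"
  assumes U: "universe U" and small: "small U \<E>" and ne: "\<E> \<noteq> {}"
    and dir: "\<And>E F. E \<in> \<E> \<Longrightarrow> F \<in> \<E> \<Longrightarrow> \<exists>G\<in>\<E>. E \<subseteq> G \<and> F \<subseteq> G"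
  obtains I :: "'u set" and le E where "I \<in> U" "directed_poset I le" "E ` I = \<E>"
    "\<And>i j. (i, j) \<in> le \<Longrightarrow> E i \<subseteq> E j"
proof -
  obtain g :: "'b set \<Rightarrow> 'u" where g: "inj_on g \<E>" "g ` \<E> \<in> U"
    using small_encoding[OF U small] .
  define le where "le = {(g E, g F) | E F. E \<in> \<E> \<and> F \<in> \<E> \<and> E \<subseteq> F}"
  have le: "(g E, g F) \<in> le \<longleftrightarrow> E \<subseteq> F" if "E \<in> \<E>" "F \<in> \<E>" for E F
    using that inj_onD[OF g(1)] unfolding le_def by blast
  have le_sub: "le \<subseteq> g ` \<E> \<times> g ` \<E>"
    by (auto simp: le_def)
  have "partial_order_on (g ` \<E>) le"
    unfolding partial_order_on_def preorder_on_def
  proof (intro conjI le_sub)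
    show "refl_on (g ` \<E>) le"
      using le by (auto simp: refl_on_def)
    show "trans le"
    proof (rule transI)
      fix x y z assume xy: "(x, y) \<in> le" and yz: "(y, z) \<in> le"
      obtain E F G where "E \<in> \<E>" "F \<in> \<E>" "G \<in> \<E>" "x = g E" "y = g F" "z = g G"
        using xy yz le_sub by blast
      then show "(x, z) \<in> le"
        using xy yz le by (metis order_trans)
    qed
    show "antisym le"
    proof (rule antisymI)
      fix x y assume xy: "(x, y) \<in> le" and yx: "(y, x) \<in> le"
      obtain E F where "E \<in> \<E>" "F \<in> \<E>" "x = g E" "y = g F"
        using xy le_sub by blast
      then show "x = y"
        using xy yx le by (metis subset_antisym)
    qed
  qed
  moreover have "\<exists>k\<in>g ` \<E>. (i, k) \<in> le \<and> (j, k) \<in> le" if "i \<in> g ` \<E>" "j \<in> g ` \<E>" for i j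
    using that dir le by (auto simp: bex_simps)
  ultimately have dp: "directed_poset (g ` \<E>) le"
    using ne by (auto simp: directed_poset_def)
  have im: "inv_into \<E> g ` g ` \<E> = \<E>"
    using g(1) by (simp add: image_image)
  have mo: "inv_into \<E> g i \<subseteq> inv_into \<E> g j" if "(i, j) \<in> le" for i j
    using that g(1) by (auto simp: le_def)
  show thesis
    by (rule that[OF g(2) dp im mo])
qed

section \<open>Finite presheaves are finitely presentable\<close>

context presheaves
begin

text \<open>These are the objects of the category of elements. Each carries its position in the
  poset, so a value shared by two fibres counts twice.\<close>

definition el :: "('a, 'u) psh \<Rightarrow> ('a \<times> 'u) set" where
  "el F = Sigma A (Fo F)"

lemma el_iff: "(a, x) \<in> el F \<longleftrightarrow> a \<in> A \<and> x \<in> Fo F a"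
  by (simp add: el_def)

lemma small_el: "F \<in> Obj C \<Longrightarrow> small U (el F)"
  unfolding el_def by (rule small_Sigma[OF univ smallA psh_U])

lemma diagram_hom:
  assumes D: "is_functor (poset_cat I le) C D" and "(i, j) \<in> le"
  shows "Fm D (i, j) \<in> hom C (Fo D i) (Fo D j)"
  using is_functor_hom[OF D, of "(i, j)"] assms by simp

lemma diagram_comp:
  assumes D: "is_functor (poset_cat I le) C D"
    and ij: "(i, j) \<in> le" and jk: "(j, k) \<in> le" and a: "a \<in> A" "x \<in> Fo (Fo D i) a"
  shows "app (Fm D (j, k)) a (app (Fm D (i, j)) a x) = app (Fm D (i, k)) a x"
proof -
  have "Fm D (i, k) = Comp C (Fm D (j, k)) (Fm D (i, j))"
    using D ij jk unfolding is_functor_def by fastforce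
  then show ?thesis
    using app_comp[OF diagram_hom[OF D ij] diagram_hom[OF D jk] a] by simp
qed

lemma diagram_cocone:
  assumes c: "cocone (poset_cat I le) C D V c" and D: "is_functor (poset_cat I le) C D"
    and ij: "(i, j) \<in> le" and j: "j \<in> I" and a: "a \<in> A" "x \<in> Fo (Fo D i) a"
  shows "app (c j) a (app (Fm D (i, j)) a x) = app (c i) a x"
  using app_comp[OF diagram_hom[OF D ij] cocone_hom[OF c] a] cocone_comp[OF c, of "(i, j)"] ij j
  by simp

text \<open>\<open>P k y\<close> says that the current point of the zigzag meets the starting point
  at some later stage. A forward step moves the meeting to a common upper bound with the new index;
  a backward step keeps the meeting stage.\<close>

lemma directed_colim_eq:
  assumes I: "directed_poset I le" and D: "is_functor (poset_cat I le) C D" and a: "a \<in> A"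
    and j: "j \<in> I" and x: "x \<in> Fo (Fo D j) a"
    and eq: "((j, x), (k, y)) \<in> colim_eq (poset_cat I le) D a"
  obtains l where "(j, l) \<in> le" "(k, l) \<in> le" "app (Fm D (j, l)) a x = app (Fm D (k, l)) a y"
proof -
  define P where "P k y \<longleftrightarrow> (\<exists>l. (j, l) \<in> le \<and> (k, l) \<in> le \<and>
      app (Fm D (j, l)) a x = app (Fm D (k, l)) a y)" for k y
  have "j \<in> Obj (poset_cat I le)"
    using j by simp
  from directed_poset_category[OF I] D a this x eq
  have "P k y \<and> k \<in> Obj (poset_cat I le) \<and> y \<in> Fo (Fo D k) a"
  proof (induction rule: colim_eq_induct)
    case refl
    then show ?case
      using directed_poset_refl[OF I j] by (auto simp: P_def)
  next
    case (forward k y f l)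
    then obtain m where m: "(j, m) \<in> le" "(k, m) \<in> le"
        "app (Fm D (j, m)) a x = app (Fm D (k, m)) a y"
      by (auto simp: P_def)
    have f: "f = (k, l)" "(k, l) \<in> le"
      using forward by auto
    obtain n where n: "(l, n) \<in> le" "(m, n) \<in> le"
      using directed_poset_ub[OF I, of l m] directed_poset_in[OF I] f m by blast
    have "app (Fm D (j, n)) a x = app (Fm D (m, n)) a (app (Fm D (j, m)) a x)"
      using diagram_comp[OF D m(1) n(2) a x] by simp
    also have "\<dots> = app (Fm D (l, n)) a (app (Fm D f) a y)"
      using diagram_comp[OF D m(2) n(2) a forward(3)] diagram_comp[OF D f(2) n(1) a forward(3)]
        m(3) f by simp
    finally show ?case
      using n directed_poset_trans[OF I m(1) n(2)] unfolding P_def by blast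
  next
    case (backward k y f l)
    then obtain m where m: "(j, m) \<in> le" "(k, m) \<in> le"
        "app (Fm D (j, m)) a x = app (Fm D (k, m)) a (app (Fm D f) a y)"
      by (auto simp: P_def)
    have f: "f = (l, k)" "(l, k) \<in> le"
      using backward by auto
    show ?case
      using diagram_comp[OF D f(2) m(2) a backward(3)] m f directed_poset_trans[OF I f(2) m(2)]
      unfolding P_def by auto
  qed
  then show thesis
    using that by (auto simp: P_def)
qed

text \<open>An arrow out of \<open>F\<close> consists of finitely many values subject to finitely
  many naturality equations. Directedness provides one stage for the values, a later one for the
  equations, and likewise one at which two factorizations merge.\<close>

lemma finite_psh_finitely_presentable:
  assumes F: "F \<in> Obj C" and fin: "finite (el F)"
  shows "finitely_presentable U C F"
  unfolding finitely_presentable_def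
proof (intro conjI allI impI F)
  fix I :: "'u set" and le D V c
  assume IU: "I \<in> U" and I: "directed_poset I le" and D: "is_functor (poset_cat I le) C D"
    and c: "is_colimit (poset_cat I le) C D V c"
  have pc: "pointwise_colimit (poset_cat I le) D V c"
    by (rule colimit_is_pointwise[OF directed_poset_category[OF I] D _ c])
      (simp add: universe_small[OF IU])
  then have cc: "cocone (poset_cat I le) C D V c"
    by (simp add: pointwise_colimit_def)
  have ch: "c i \<in> hom C (Fo D i) V" if "i \<in> I" for i
    using cocone_hom[OF cc] that by simp
  have later: "\<exists>l. (j, l) \<in> le \<and> (k, l) \<in> le \<and> app (Fm D (j, l)) a x = app (Fm D (k, l)) a y"
    if "a \<in> A" "j \<in> I" "k \<in> I" "x \<in> Fo (Fo D j) a" "y \<in> Fo (Fo D k) a"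
      "app (c j) a x = app (c k) a y" for a j k x y
  proof -
    have "((j, x), (k, y)) \<in> colim_eq (poset_cat I le) D a"
      using pc that unfolding pointwise_colimit_def by simp
    then show ?thesis
      using directed_colim_eq[OF I D that(1,2,4)] by metis
  qed
  show "is_colimit (poset_cat I le) (set_cat UNIV)
     (comp_ftor (poset_cat I le) (hom_functor C F) D)
     (Fo (hom_functor C F) V) (\<lambda>i. Fm (hom_functor C F) (c i))"
  proof (rule hom_functor_colimitI[OF category_C I D cc F])
    fix t assume t: "t \<in> hom C F V"
    have "\<exists>j z. j \<in> I \<and> z \<in> Fo (Fo D j) (fst p) \<and> app t (fst p) (snd p) = app (c j) (fst p) z"
      if "p \<in> el F" for p
    proof -
      obtain a x where p: "p = (a, x)" "a \<in> A" "x \<in> Fo F a"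
        using \<open>p \<in> el F\<close> by (auto simp: el_def)
      then show ?thesis
        using pc app_in[OF t p(2,3)] unfolding pointwise_colimit_def by fastforce
    qed
    then obtain j z where jz: "\<And>p. p \<in> el F \<Longrightarrow> j p \<in> I"
      "\<And>p. p \<in> el F \<Longrightarrow> z p \<in> Fo (Fo D (j p)) (fst p)"
      "\<And>p. p \<in> el F \<Longrightarrow> app t (fst p) (snd p) = app (c (j p)) (fst p) (z p)"
      by metis
    have "j ` el F \<subseteq> I"
      using jz(1) by blast
    then obtain u where u: "u \<in> I" "\<And>p. p \<in> el F \<Longrightarrow> (j p, u) \<in> le"
      using directed_poset_finite_ub[OF I finite_imageI[OF fin]] by (metis imageI)
    \<comment> \<open>This lifts all values of \<open>t\<close> to the single stage
      \<open>u\<close>, not yet compatibly with restriction.\<close>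
    define z' where "z' a x = app (Fm D (j (a, x), u)) a (z (a, x))" for a x
    have z': "z' a x \<in> Fo (Fo D u) a" "app (c u) a (z' a x) = app t a x" if "a \<in> A" "x \<in> Fo F a" for a x
    proof -
      have p: "(a, x) \<in> el F"
        using that by (simp add: el_iff)
      show "z' a x \<in> Fo (Fo D u) a"
        using app_in[OF diagram_hom[OF D u(2)[OF p]] that(1)] jz(2)[OF p] by (simp add: z'_def)
      show "app (c u) a (z' a x) = app t a x"
        using diagram_cocone[OF cc D u(2)[OF p] u(1) that(1)] jz[OF p] by (simp add: z'_def)
    qed
    \<comment> \<open>A member \<open>((a, x), b)\<close> stands for the naturality equation of
      \<open>x\<close> along \<open>b \<le> a\<close>.\<close>
    define T where "T = {(p, b). p \<in> el F \<and> (b, fst p) \<in> r}"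
    have T_iff: "((a, x), b) \<in> T \<longleftrightarrow> x \<in> Fo F a \<and> (b, a) \<in> r" for a x b
      using r_in_A by (auto simp: T_def el_iff)
    \<comment> \<open>Every such \<open>b\<close> carries the element \<open>res F b a x\<close>, so
      finiteness of \<open>el F\<close> also bounds the number of equations.\<close>
    have "T \<subseteq> el F \<times> fst ` el F"
    proof (clarsimp simp: T_iff el_iff)
      fix a x b assume ba: "(b, a) \<in> r" and x: "x \<in> Fo F a"
      have "(b, res F b a x) \<in> el F"
        using res_in[OF F ba x] r_in_A[OF ba] by (simp add: el_iff)
      then show "a \<in> A \<and> b \<in> fst ` el F"
        using r_in_A[OF ba] by force
    qed
    then have finT: "finite T"
      using fin by (meson finite_SigmaI finite_imageI finite_subset)
    have "\<exists>l. (u, l) \<in> le \<and> app (Fm D (u, l)) b (res (Fo D u) b a (z' a x))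
        = app (Fm D (u, l)) b (z' b (res F b a x))" if "((a, x), b) \<in> T" for a x b
    proof -
      have ba: "(b, a) \<in> r" and x: "x \<in> Fo F a"
        using that by (auto simp: T_iff)
      note ab = r_in_A[OF ba]
      note z'a = z'[OF ab(2) x] and z'b = z'[OF ab(1) res_in[OF F ba x]]
      have "app (c u) b (res (Fo D u) b a (z' a x)) = app (c u) b (z' b (res F b a x))"
        using app_res[OF ch[OF u(1)] ba z'a(1)] z'a z'b app_res[OF t ba x] by simp
      then show ?thesis
        using later[OF ab(1) u(1) u(1) res_in[OF _ ba z'a(1)] z'b(1)] hom_dom[OF ch[OF u(1)]]
        by blast
    qed
    then have "\<forall>q\<in>T. \<exists>l. (u, l) \<in> le \<and>
        app (Fm D (u, l)) (snd q) (res (Fo D u) (snd q) (fst (fst q)) (z' (fst (fst q)) (snd (fst q))))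
        = app (Fm D (u, l)) (snd q) (z' (snd q) (res F (snd q) (fst (fst q)) (snd (fst q))))"
      by auto
    from bchoice[OF this] obtain l where l: "\<And>a x b. ((a, x), b) \<in> T \<Longrightarrow> (u, l ((a, x), b)) \<in> le \<and>
        app (Fm D (u, l ((a, x), b))) b (res (Fo D u) b a (z' a x))
        = app (Fm D (u, l ((a, x), b))) b (z' b (res F b a x))"
      by force
    \<comment> \<open>Inserting \<open>u\<close> puts \<open>w\<close> above \<open>u\<close> even
      when \<open>T\<close> is empty.\<close>
    have "insert u (l ` T) \<subseteq> I"
      using u(1) l directed_poset_in[OF I] by fastforce
    then obtain w where "w \<in> I" "\<And>i. i \<in> insert u (l ` T) \<Longrightarrow> (i, w) \<in> le"
      using directed_poset_finite_ub[OF I finite.insertI[OF finite_imageI[OF finT]]] by metis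
    then have w: "w \<in> I" "(u, w) \<in> le" "\<And>q. q \<in> T \<Longrightarrow> (l q, w) \<in> le"
      by blast+
    note Duw = diagram_hom[OF D w(2)]
    let ?s = "mkarr F (\<lambda>a x. app (Fm D (u, w)) a (z' a x)) (Fo D w)"
    have s: "?s \<in> hom C F (Fo D w)"
    proof (rule mkarr_hom[OF F hom_cod[OF Duw]])
      show "app (Fm D (u, w)) a (z' a x) \<in> Fo (Fo D w) a" if "a \<in> A" "x \<in> Fo F a" for a x
        using app_in[OF Duw that(1) z'(1)[OF that]] .
      fix a b x assume ba: "(b, a) \<in> r" and x: "x \<in> Fo F a"
      note ab = r_in_A[OF ba]
      note z'a = z'[OF ab(2) x] and z'b = z'[OF ab(1) res_in[OF F ba x]]
      have q: "((a, x), b) \<in> T"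
        using ba x by (simp add: T_iff)
      let ?l = "l ((a, x), b)"
      have "app (Fm D (u, w)) b (z' b (res F b a x)) =
          app (Fm D (?l, w)) b (app (Fm D (u, ?l)) b (z' b (res F b a x)))"
        using diagram_comp[OF D _ w(3)[OF q] ab(1) z'b(1)] l[OF q] by simp
      also have "\<dots> = app (Fm D (u, w)) b (res (Fo D u) b a (z' a x))"
        using diagram_comp[OF D _ w(3)[OF q] ab(1) res_in[OF hom_dom[OF Duw] ba z'a(1)]] l[OF q]
        by simp
      also have "\<dots> = res (Fo D w) b a (app (Fm D (u, w)) a (z' a x))"
        using app_res[OF Duw ba z'a(1)] .
      finally show "app (Fm D (u, w)) b (z' b (res F b a x))
          = res (Fo D w) b a (app (Fm D (u, w)) a (z' a x))" .
    qed
    have "Comp C (c w) ?s = t"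
    proof (rule arr_eqI[OF comp_hom[OF category_C s ch[OF w(1)]] t])
      show "app (Comp C (c w) ?s) a x = app t a x" if "a \<in> A" "x \<in> Fo F a" for a x
        using app_comp[OF s ch[OF w(1)] that] that z'[OF that]
          diagram_cocone[OF cc D w(2,1) that(1) z'(1)[OF that]] by simp
    qed
    then show "\<exists>i\<in>I. \<exists>s\<in>hom C F (Fo D i). Comp C (c i) s = t"
      using w(1) s by blast
  next
    fix i k s s'
    assume ik: "i \<in> I" "k \<in> I" and s: "s \<in> hom C F (Fo D i)" and s': "s' \<in> hom C F (Fo D k)"
      and eq: "Comp C (c i) s = Comp C (c k) s'"
    have "\<exists>l. (i, l) \<in> le \<and> (k, l) \<in> le \<and>
        app (Fm D (i, l)) a (app s a x) = app (Fm D (k, l)) a (app s' a x)" if "(a, x) \<in> el F" for a x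
    proof -
      have a: "a \<in> A" and x: "x \<in> Fo F a"
        using that by (auto simp: el_iff)
      have "app (c i) a (app s a x) = app (c k) a (app s' a x)"
        using app_comp[OF s ch[OF ik(1)] a x] app_comp[OF s' ch[OF ik(2)] a x] eq by simp
      then show ?thesis
        using later[OF a ik app_in[OF s a x] app_in[OF s' a x]] by blast
    qed
    then have "\<forall>p\<in>el F. \<exists>l. (i, l) \<in> le \<and> (k, l) \<in> le \<and>
        app (Fm D (i, l)) (fst p) (app s (fst p) (snd p))
        = app (Fm D (k, l)) (fst p) (app s' (fst p) (snd p))"
      by auto
    from bchoice[OF this] obtain l where l: "\<And>a x. (a, x) \<in> el F \<Longrightarrow>
        (i, l (a, x)) \<in> le \<and> (k, l (a, x)) \<in> le \<and>
        app (Fm D (i, l (a, x))) a (app s a x) = app (Fm D (k, l (a, x))) a (app s' a x)"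
      by force
    \<comment> \<open>The finitely many stages at which the values of \<open>s\<close> and
      \<open>s'\<close> merge, element by element, are brought under one bound.\<close>
    have "{i, k} \<union> l ` el F \<subseteq> I"
      using ik l directed_poset_in[OF I] by fastforce
    moreover have "finite ({i, k} \<union> l ` el F)"
      using fin by simp
    ultimately obtain w where "w \<in> I" "\<And>j. j \<in> {i, k} \<union> l ` el F \<Longrightarrow> (j, w) \<in> le"
      using directed_poset_finite_ub[OF I] by metis
    then have w: "w \<in> I" "(i, w) \<in> le" "(k, w) \<in> le" "\<And>p. p \<in> el F \<Longrightarrow> (l p, w) \<in> le"
      by blast+
    note Di = diagram_hom[OF D w(2)] and Dk = diagram_hom[OF D w(3)]
    have "Comp C (Fm D (i, w)) s = Comp C (Fm D (k, w)) s'"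
    proof (rule arr_eqI[OF comp_hom[OF category_C s Di] comp_hom[OF category_C s' Dk]])
      fix a x assume a: "a \<in> A" and x: "x \<in> Fo F a"
      then have p: "(a, x) \<in> el F"
        by (simp add: el_iff)
      have "app (Fm D (i, w)) a (app s a x) = app (Fm D (k, w)) a (app s' a x)"
        using diagram_comp[OF D _ w(4)[OF p] a app_in[OF s a x]]
          diagram_comp[OF D _ w(4)[OF p] a app_in[OF s' a x]] l[OF p] by metis
      then show "app (Comp C (Fm D (i, w)) s) a x = app (Comp C (Fm D (k, w)) s') a x"
        using app_comp[OF s Di a x] app_comp[OF s' Dk a x] by simp
    qed
    then show "\<exists>l. (i, l) \<in> le \<and> (k, l) \<in> le \<and>
        Comp C (Fm D (i, l)) s = Comp C (Fm D (k, l)) s'"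
      using w by blast
  qed
qed

section \<open>Subpresheaves as restriction-closed sets of elements, and their directed
  unions\<close>

definition subpsh :: "('a, 'u) psh \<Rightarrow> ('a \<times> 'u) set \<Rightarrow> bool" where
  "subpsh X E \<longleftrightarrow> E \<subseteq> el X \<and> (\<forall>a x b. (a, x) \<in> E \<longrightarrow> (b, a) \<in> r \<longrightarrow> (b, res X b a x) \<in> E)"

text \<open>Renaming the elements of a finite subpresheaf along \<open>\<phi>\<close> moves it into a fixed small
  set of finite presheaves.\<close>

definition copy_psh :: "('a, 'u) psh \<Rightarrow> ('a \<times> 'u) set \<Rightarrow> ('u \<Rightarrow> 'u) \<Rightarrow> ('a, 'u) psh" where
  "copy_psh X E \<phi> = mkpsh (\<lambda>a. \<phi> ` {x. (a, x) \<in> E})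
     (\<lambda>b a y. \<phi> (res X b a (inv_into (snd ` E) \<phi> y)))"

lemma Fo_copy_psh: "a \<in> A \<Longrightarrow> Fo (copy_psh X E \<phi>) a = \<phi> ` {x. (a, x) \<in> E}"
  by (simp add: copy_psh_def)

text \<open>The renaming is injective on the values of all fibres together, so one inverse serves
  every fibre.\<close>

lemma inv_copy:
  assumes "inj_on \<phi> (snd ` E)" "(a, x) \<in> E"
  shows "inv_into (snd ` E) \<phi> (\<phi> x) = x"
proof -
  have "x \<in> snd ` E"
    using assms(2) by force
  then show ?thesis
    using assms(1) by simp
qed

lemma res_copy_psh:
  assumes "inj_on \<phi> (snd ` E)" "(b, a) \<in> r" "(a, x) \<in> E"
  shows "res (copy_psh X E \<phi>) b a (\<phi> x) = \<phi> (res X b a x)"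
  using assms by (simp add: copy_psh_def inv_copy)

lemma copy_psh_Obj:
  assumes X: "X \<in> Obj C" and E: "subpsh X E" and \<phi>: "inj_on \<phi> (snd ` E)"
  shows "copy_psh X E \<phi> \<in> Obj C"
  unfolding copy_psh_def
proof (rule mkpsh_Obj)
  have EX: "x \<in> Fo X a" if "(a, x) \<in> E" for a x
    using E that by (auto simp: subpsh_def el_iff)
  have Er: "(b, res X b a x) \<in> E" if "(a, x) \<in> E" "(b, a) \<in> r" for a b x
    using E that by (auto simp: subpsh_def)
  show "\<phi> ` {x. (a, x) \<in> E} \<in> U" if "a \<in> A" for a
  proof -
    have "{x. (a, x) \<in> E} \<subseteq> Fo X a"
      using EX by blast
    then show ?thesis
      by (rule small_in_universe[OF univ small_image[OF small_subset[OF _ universe_small]]])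
        (rule psh_U[OF X that])
  qed
  show "\<phi> (res X b a (inv_into (snd ` E) \<phi> y)) \<in> \<phi> ` {x. (b, x) \<in> E}"
    if "(b, a) \<in> r" "y \<in> \<phi> ` {x. (a, x) \<in> E}" for a b y
    using that Er inv_copy[OF \<phi>] by auto
  show "\<phi> (res X a a (inv_into (snd ` E) \<phi> y)) = y"
    if "a \<in> A" "y \<in> \<phi> ` {x. (a, x) \<in> E}" for a y
    using that EX inv_copy[OF \<phi>] res_id[OF X] by auto
  show "\<phi> (res X c b (inv_into (snd ` E) \<phi> (\<phi> (res X b a (inv_into (snd ` E) \<phi> y)))))
      = \<phi> (res X c a (inv_into (snd ` E) \<phi> y))"
    if ba: "(b, a) \<in> r" and cb: "(c, b) \<in> r" and y: "y \<in> \<phi> ` {x. (a, x) \<in> E}" for a b c y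
  proof -
    obtain x where x: "(a, x) \<in> E" "y = \<phi> x"
      using y by auto
    show ?thesis
      using x inv_copy[OF \<phi> x(1)] inv_copy[OF \<phi> Er[OF x(1) ba]] res_res[OF X ba cb EX[OF x(1)]]
      by simp
  qed
qed

lemma copy_map_hom:
  assumes X: "X \<in> Obj C" and E: "subpsh X E" and \<phi>: "inj_on \<phi> (snd ` E)"
    and F: "subpsh X F" and \<psi>: "inj_on \<psi> (snd ` F)" and EF: "E \<subseteq> F"
  shows "mkarr (copy_psh X E \<phi>) (\<lambda>a y. \<psi> (inv_into (snd ` E) \<phi> y)) (copy_psh X F \<psi>)
    \<in> hom C (copy_psh X E \<phi>) (copy_psh X F \<psi>)"
proof (rule mkarr_hom[OF copy_psh_Obj[OF X E \<phi>] copy_psh_Obj[OF X F \<psi>]])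
  show "\<psi> (inv_into (snd ` E) \<phi> y) \<in> Fo (copy_psh X F \<psi>) a"
    if "a \<in> A" "y \<in> Fo (copy_psh X E \<phi>) a" for a y
    using that EF inv_copy[OF \<phi>] by (auto simp: Fo_copy_psh)
  fix a b y assume ba: "(b, a) \<in> r" and y: "y \<in> Fo (copy_psh X E \<phi>) a"
  obtain x where x: "(a, x) \<in> E" "y = \<phi> x"
    using y r_in_A[OF ba] by (auto simp: Fo_copy_psh)
  have "(b, res X b a x) \<in> E"
    using E ba x(1) by (auto simp: subpsh_def)
  then show "\<psi> (inv_into (snd ` E) \<phi> (res (copy_psh X E \<phi>) b a y))
      = res (copy_psh X F \<psi>) b a (\<psi> (inv_into (snd ` E) \<phi> y))"
    using res_copy_psh[OF \<phi> ba x(1), of X] res_copy_psh[OF \<psi> ba, of x X] x EF inv_copy[OF \<phi>]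
    by (simp add: subset_iff)
qed

lemma copy_incl_hom:
  assumes X: "X \<in> Obj C" and E: "subpsh X E" and \<phi>: "inj_on \<phi> (snd ` E)"
  shows "mkarr (copy_psh X E \<phi>) (\<lambda>a y. inv_into (snd ` E) \<phi> y) X \<in> hom C (copy_psh X E \<phi>) X"
proof (rule mkarr_hom[OF copy_psh_Obj[OF X E \<phi>] X])
  show "inv_into (snd ` E) \<phi> y \<in> Fo X a" if "a \<in> A" "y \<in> Fo (copy_psh X E \<phi>) a" for a y
    using that E inv_copy[OF \<phi>] by (auto simp: Fo_copy_psh subpsh_def el_iff)
  fix a b y assume ba: "(b, a) \<in> r" and y: "y \<in> Fo (copy_psh X E \<phi>) a"
  obtain x where x: "(a, x) \<in> E" "y = \<phi> x"
    using y r_in_A[OF ba] by (auto simp: Fo_copy_psh)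
  have "(b, res X b a x) \<in> E"
    using E ba x(1) by (auto simp: subpsh_def)
  then show "inv_into (snd ` E) \<phi> (res (copy_psh X E \<phi>) b a y)
      = res X b a (inv_into (snd ` E) \<phi> y)"
    using res_copy_psh[OF \<phi> ba x(1), of X] x inv_copy[OF \<phi>] by simp
qed

text \<open>Every stage has its own renaming. A transition map is an inclusion in disguise: it
  decodes with the renaming of its source and encodes with that of its target.\<close>

definition union_diagram where
  "union_diagram X I le E \<phi> = \<lparr>Fo = \<lambda>i\<in>I. copy_psh X (E i) (\<phi> i),
     Fm = \<lambda>p\<in>le. mkarr (copy_psh X (E (fst p)) (\<phi> (fst p)))
       (\<lambda>a y. \<phi> (snd p) (inv_into (snd ` E (fst p)) (\<phi> (fst p)) y))
       (copy_psh X (E (snd p)) (\<phi> (snd p)))\<rparr>"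

definition union_cocone where
  "union_cocone X E \<phi> i =
     mkarr (copy_psh X (E i) (\<phi> i)) (\<lambda>a y. inv_into (snd ` E i) (\<phi> i) y) X"

text \<open>Joint surjectivity of the legs is \<open>un\<close>. Names at two stages with the same
  image denote the same element of \<open>X\<close>, and both are carried to its name at a common
  upper bound.\<close>

lemma union_colimit:
  assumes X: "X \<in> Obj C" and I: "directed_poset I le"
    and E: "\<And>i. i \<in> I \<Longrightarrow> subpsh X (E i)" and \<phi>: "\<And>i. i \<in> I \<Longrightarrow> inj_on (\<phi> i) (snd ` E i)"
    and mono: "\<And>i j. (i, j) \<in> le \<Longrightarrow> E i \<subseteq> E j" and un: "(\<Union>i\<in>I. E i) = el X"
  shows union_diagram_functor: "is_functor (poset_cat I le) C (union_diagram X I le E \<phi>)"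
    and union_is_colimit:
      "is_colimit (poset_cat I le) C (union_diagram X I le E \<phi>) X (union_cocone X E \<phi>)"
proof -
  let ?J = "poset_cat I le" and ?D = "union_diagram X I le E \<phi>" and ?c = "union_cocone X E \<phi>"
  define Q where "Q i = copy_psh X (E i) (\<phi> i)" for i
  have in_I: "i \<in> I" "j \<in> I" if "(i, j) \<in> le" for i j
    using directed_poset_in[OF I that] by auto
  have FoD: "Fo ?D i = Q i" if "i \<in> I" for i
    using that by (simp add: union_diagram_def Q_def)
  have Q: "Q i \<in> Obj C" if "i \<in> I" for i
    unfolding Q_def using copy_psh_Obj[OF X E[OF that] \<phi>[OF that]] .
  have QE: "Fo (Q i) a = \<phi> i ` {x. (a, x) \<in> E i}" if "a \<in> A" for i a
    using that by (simp add: Q_def Fo_copy_psh)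
  have Dm: "Fm ?D (i, j) \<in> hom C (Q i) (Q j)" if "(i, j) \<in> le" for i j
    using copy_map_hom[OF X E \<phi> E \<phi> mono[OF that]] in_I[OF that] that
    by (simp add: union_diagram_def Q_def)
  have appD: "app (Fm ?D (i, j)) a (\<phi> i x) = \<phi> j x"
    if "(i, j) \<in> le" "a \<in> A" "(a, x) \<in> E i" for i j a x
    using that inv_copy[OF \<phi>] in_I[OF that(1)] QE[of a i] by (simp add: union_diagram_def Q_def)
  have ch: "?c i \<in> hom C (Q i) X" if "i \<in> I" for i
    using copy_incl_hom[OF X E \<phi>] that by (simp add: union_cocone_def Q_def)
  have appc: "app (?c i) a (\<phi> i x) = x" if "i \<in> I" "a \<in> A" "(a, x) \<in> E i" for i a x
    using that inv_copy[OF \<phi>] QE[of a i] by (simp add: union_cocone_def Q_def)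
  show D: "is_functor ?J C ?D"
    unfolding is_functor_def
  proof (intro conjI ballI impI)
    show "Fo ?D \<in> Obj ?J \<rightarrow>\<^sub>E Obj C"
      using Q by (auto simp: union_diagram_def Q_def)
    show "Fm ?D \<in> extensional (Arr ?J)"
      by (simp add: union_diagram_def)
    show "Fm ?D f \<in> hom C (Fo ?D (Dom ?J f)) (Fo ?D (Cod ?J f))" if "f \<in> Arr ?J" for f
      using that Dm in_I FoD by (cases f) simp
    show "Fm ?D (Ident ?J i) = Ident C (Fo ?D i)" if "i \<in> Obj ?J" for i
    proof -
      have i: "i \<in> I" "(i, i) \<in> le"
        using that directed_poset_refl[OF I] by auto
      have "Fm ?D (i, i) = Ident C (Q i)"
      proof (rule arr_eqI[OF Dm[OF i(2)] ident_hom[OF category_C Q[OF i(1)]]])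
        show "app (Fm ?D (i, i)) a y = app (Ident C (Q i)) a y" if "a \<in> A" "y \<in> Fo (Q i) a" for a y
          using that QE appD[OF i(2) that(1)] app_ident by auto
      qed
      then show ?thesis
        using FoD i by simp
    qed
    show "Fm ?D (Comp ?J g f) = Comp C (Fm ?D g) (Fm ?D f)"
      if fg: "f \<in> Arr ?J" "g \<in> Arr ?J" "Cod ?J f = Dom ?J g" for f g
    proof -
      obtain i j k where ijk: "f = (i, j)" "g = (j, k)" "(i, j) \<in> le" "(j, k) \<in> le"
        using fg by (cases f, cases g) auto
      note ik = directed_poset_trans[OF I ijk(3,4)]
      have "Fm ?D (i, k) = Comp C (Fm ?D (j, k)) (Fm ?D (i, j))"
      proof (rule arr_eqI[OF Dm[OF ik] comp_hom[OF category_C Dm[OF ijk(3)] Dm[OF ijk(4)]]])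
        fix a y assume a: "a \<in> A" and y: "y \<in> Fo (Q i) a"
        then obtain x where x: "(a, x) \<in> E i" "y = \<phi> i x"
          using QE by auto
        have "(a, x) \<in> E j"
          using mono ijk x by blast
        then show "app (Fm ?D (i, k)) a y = app (Comp C (Fm ?D (j, k)) (Fm ?D (i, j))) a y"
          using app_comp[OF Dm[OF ijk(3)] Dm[OF ijk(4)] a y] x appD[OF ik a x(1)]
            appD[OF ijk(3) a x(1)] appD[OF ijk(4) a] by simp
      qed
      then show ?thesis
        using ijk by simp
    qed
  qed
  have "cocone ?J C ?D X ?c"
    unfolding cocone_def
  proof (intro conjI ballI X)
    show "?c i \<in> hom C (Fo ?D i) X" if "i \<in> Obj ?J" for i
      using that ch FoD by simp
    show "Comp C (?c (Cod ?J f)) (Fm ?D f) = ?c (Dom ?J f)" if f: "f \<in> Arr ?J" for f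
    proof -
      obtain i j where ij: "f = (i, j)" "(i, j) \<in> le"
        using f by (cases f) simp
      note I' = in_I[OF ij(2)]
      have "Comp C (?c j) (Fm ?D (i, j)) = ?c i"
      proof (rule arr_eqI[OF comp_hom[OF category_C Dm[OF ij(2)] ch[OF I'(2)]] ch[OF I'(1)]])
        fix a y assume a: "a \<in> A" and y: "y \<in> Fo (Q i) a"
        then obtain x where x: "(a, x) \<in> E i" "y = \<phi> i x"
          using QE by auto
        have "(a, x) \<in> E j"
          using mono ij x by blast
        then show "app (Comp C (?c j) (Fm ?D (i, j))) a y = app (?c i) a y"
          using app_comp[OF Dm[OF ij(2)] ch[OF I'(2)] a y] x appD[OF ij(2) a x(1)]
            appc[OF I'(1) a x(1)] appc[OF I'(2) a] by simp
      qed
      then show ?thesis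
        using ij by simp
    qed
  qed
  moreover have "\<exists>i\<in>Obj ?J. \<exists>y\<in>Fo (Fo ?D i) a. v = app (?c i) a y"
    if a: "a \<in> A" and v: "v \<in> Fo X a" for a v
  proof -
    have "(a, v) \<in> (\<Union>i\<in>I. E i)"
      using un a v by (simp add: el_iff)
    then obtain i where i: "i \<in> I" "(a, v) \<in> E i"
      by blast
    then have "\<phi> i v \<in> Fo (Fo ?D i) a" "v = app (?c i) a (\<phi> i v)"
      using FoD QE[OF a] appc[OF _ a] by auto
    then show ?thesis
      using i by auto
  qed
  moreover have "((i, y), (j, z)) \<in> colim_eq ?J ?D a"
    if a: "a \<in> A" and i: "i \<in> Obj ?J" and j: "j \<in> Obj ?J" and y: "y \<in> Fo (Fo ?D i) a"
      and z: "z \<in> Fo (Fo ?D j) a" and eq: "app (?c i) a y = app (?c j) a z" for a i j y z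
  proof -
    have ij: "i \<in> I" "j \<in> I"
      using i j by auto
    obtain x where x: "(a, x) \<in> E i" "y = \<phi> i x"
      using y FoD ij QE[OF a] by auto
    obtain x' where x': "(a, x') \<in> E j" "z = \<phi> j x'"
      using z FoD ij QE[OF a] by auto
    have xx': "x = x'"
      using eq x x' appc[OF ij(1) a x(1)] appc[OF ij(2) a x'(1)] by simp
    obtain l where l: "(i, l) \<in> le" "(j, l) \<in> le"
      using directed_poset_ub[OF I ij] .
    have step: "((k, \<phi> k x), (l, \<phi> l x)) \<in> colim_eq ?J ?D a"
      if "(k, l) \<in> le" "(a, x) \<in> E k" for k
      using that appD[OF that(1) a that(2)] in_I[OF that(1)] FoD QE[OF a]
      by (intro colim_step_in_eq) (force simp: colim_step_def)
    show ?thesis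
      using step[OF l(1)] step[OF l(2)] x x' xx' colim_eq_trans colim_eq_sym by metis
  qed
  ultimately have "pointwise_colimit ?J ?D X ?c"
    unfolding pointwise_colimit_def by blast
  then show "is_colimit ?J C ?D X ?c"
    by (rule pointwise_colimit_is_colimit[OF directed_poset_category[OF I] D])
qed

lemma finitely_presentable_in_directed_union:
  assumes X: "finitely_presentable U C X" and small: "small U \<E>" and ne: "\<E> \<noteq> {}"
    and dir: "\<And>E F. E \<in> \<E> \<Longrightarrow> F \<in> \<E> \<Longrightarrow> \<exists>G\<in>\<E>. E \<subseteq> G \<and> F \<subseteq> G"
    and sub: "\<And>E. E \<in> \<E> \<Longrightarrow> subpsh X E" and un: "\<Union>\<E> = el X"
  shows "el X \<in> \<E>"
proof -
  have XO: "X \<in> Obj C"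
    using X by (simp add: finitely_presentable_def)
  obtain I :: "'u set" and le E where I: "I \<in> U" "directed_poset I le" "E ` I = \<E>"
    "\<And>i j. (i, j) \<in> le \<Longrightarrow> E i \<subseteq> E j"
    using directed_encoding[OF univ small ne dir] by metis
  have E: "subpsh X (E i)" "inj_on (\<lambda>x. x) (snd ` E i)" if "i \<in> I" for i
    using sub I(3) that by auto
  have un': "(\<Union>i\<in>I. E i) = el X"
    using I(3) un by simp
  \<comment> \<open>Here the subpresheaves are compared with \<open>X\<close> itself, so their
    elements keep their names.\<close>
  let ?\<phi> = "\<lambda>i x. x"
  note D = union_diagram_functor[where \<phi> = ?\<phi>, OF XO I(2) E I(4) un']
  note c = union_is_colimit[where \<phi> = ?\<phi>, OF XO I(2) E I(4) un']
  obtain i s where i: "i \<in> I" and s: "s \<in> hom C X (Fo (union_diagram X I le E ?\<phi>) i)"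
    "Comp C (union_cocone X E ?\<phi> i) s = Ident C X"
    using finitely_presentable_factor[OF category_C X I(1,2) D c ident_hom[OF category_C XO]]
    by blast
  have s': "s \<in> hom C X (copy_psh X (E i) (\<lambda>x. x))"
    using s(1) i by (simp add: union_diagram_def)
  have c': "union_cocone X E ?\<phi> i \<in> hom C (copy_psh X (E i) (\<lambda>x. x)) X"
    using copy_incl_hom[OF XO E[OF i]] by (simp add: union_cocone_def)
  \<comment> \<open>The section \<open>s\<close> takes its values in \<open>E i\<close>, and the leg
    is an inclusion; hence \<open>x\<close> is its own image under \<open>s\<close>.\<close>
  have "(a, x) \<in> E i" if "(a, x) \<in> el X" for a x
  proof -
    have a: "a \<in> A" and x: "x \<in> Fo X a"
      using that by (auto simp: el_iff)
    have y: "(a, app s a x) \<in> E i"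
      using app_in[OF s' a x] a by (simp add: Fo_copy_psh)
    have "x = app (union_cocone X E ?\<phi> i) a (app s a x)"
      using app_comp[OF s' c' a x] s(2) app_ident[OF a x] by simp
    also have "\<dots> = app s a x"
      using a y app_in[OF s' a x] inv_copy[OF E(2)[OF i] y] by (simp add: union_cocone_def)
    finally show ?thesis
      using y by simp
  qed
  then have "E i = el X"
    using E(1)[OF i] by (auto simp: subpsh_def)
  then show ?thesis
    using I(3) i by blast
qed


section \<open>Finite principal down-sets\<close>

text \<open>A presheaf is recovered from the graph of all its restriction maps: the part over
  \<open>a \<le> a\<close> gives the fibres, the rest gives the maps. Here this graph is a finite
  subset of a small set.\<close>

lemma small_finite_presheaves:
  assumes N: "N \<in> U"
  shows "small U {F \<in> Obj C. finite (el F) \<and> snd ` el F \<subseteq> N}" (is "small U ?S")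
proof -
  define gr where "gr F = {((a, x), (b, y)). (b, a) \<in> r \<and> x \<in> Fo F a \<and> y = res F b a x}"
    for F :: "('a, 'u) psh"
  have gr_iff: "((a, x), (b, y)) \<in> gr F \<longleftrightarrow> (b, a) \<in> r \<and> x \<in> Fo F a \<and> y = res F b a x"
    for a x b y and F :: "('a, 'u) psh"
    by (simp add: gr_def)
  have "F = G" if F: "F \<in> Obj C" and G: "G \<in> Obj C" and eq: "gr F = gr G" for F G
  proof (rule psh_eqI[OF F G])
    have "x \<in> Fo F a \<longleftrightarrow> ((a, x), (a, x)) \<in> gr F" "x \<in> Fo G a \<longleftrightarrow> ((a, x), (a, x)) \<in> gr G"
      if "a \<in> A" for a x
      using that refl_r res_id[OF F] res_id[OF G] by (auto simp: gr_iff)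
    then show "Fo F a = Fo G a" if "a \<in> A" for a
      using that eq by blast
    show "res F b a x = res G b a x" if "(b, a) \<in> r" "x \<in> Fo F a" for a b x
      using that eq gr_iff by metis
  qed
  then have "inj_on gr ?S"
    by (auto intro: inj_onI)
  moreover have "gr F \<in> Fpow ((A \<times> N) \<times> (A \<times> N))" if F: "F \<in> ?S" for F
  proof -
    have "gr F \<subseteq> el F \<times> el F"
      using F res_in r_in_A by (auto simp: gr_def el_iff)
    moreover have "el F \<subseteq> A \<times> N"
      using F by (force simp: el_def)
    moreover have "finite (el F \<times> el F)"
      using F by simp
    ultimately show ?thesis
      unfolding Fpow_def using finite_subset by blast
  qed
  ultimately have "?S \<lesssim> Fpow ((A \<times> N) \<times> (A \<times> N))"
    unfolding lepoll_def by blast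
  then show ?thesis
    by (rule small_lepoll) (intro small_Fpow small_Times univ smallA universe_small N)
qed

definition finite_subpshs :: "('a, 'u) psh \<Rightarrow> ('a \<times> 'u) set set" where
  "finite_subpshs X = {E. subpsh X E \<and> finite E}"

lemma small_finite_subpshs: "X \<in> Obj C \<Longrightarrow> small U (finite_subpshs X)"
  by (rule small_subset[OF _ small_Fpow[OF univ small_el]])
    (auto simp: finite_subpshs_def Fpow_def subpsh_def)

lemma finite_subpshs_nonempty: "finite_subpshs X \<noteq> {}"
proof -
  have "{} \<in> finite_subpshs X"
    by (simp add: finite_subpshs_def subpsh_def)
  then show ?thesis
    by blast
qed

lemma finite_subpshs_directed:
  assumes "E \<in> finite_subpshs X" "F \<in> finite_subpshs X"
  shows "\<exists>G\<in>finite_subpshs X. E \<subseteq> G \<and> F \<subseteq> G"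
proof
  show "E \<union> F \<in> finite_subpshs X"
    using assms by (auto simp: finite_subpshs_def subpsh_def)
qed blast

text \<open>An element generates the subpresheaf of its restrictions, at most one for each member of
  a principal down-set. This is where finiteness of these down-sets enters.\<close>

lemma finite_subpshs_Union:
  assumes fin: "\<And>a. a \<in> A \<Longrightarrow> finite {b. (b, a) \<in> r}" and X: "X \<in> Obj C"
  shows "\<Union>(finite_subpshs X) = el X"
proof
  show "\<Union>(finite_subpshs X) \<subseteq> el X"
    by (auto simp: finite_subpshs_def subpsh_def)
  show "el X \<subseteq> \<Union>(finite_subpshs X)"
  proof (clarsimp simp: el_iff)
    fix a x assume a: "a \<in> A" and x: "x \<in> Fo X a"
    let ?E = "(\<lambda>b. (b, res X b a x)) ` {b. (b, a) \<in> r}"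
    have "subpsh X ?E"
      unfolding subpsh_def
      using x res_in[OF X] res_res[OF X] r_in_A trans_r by (auto simp: el_iff image_iff)
    then have "?E \<in> finite_subpshs X"
      using fin[OF a] by (simp add: finite_subpshs_def)
    moreover have "(a, x) \<in> ?E"
      using res_id[OF X a x] refl_r[OF a] by force
    ultimately show "\<exists>E\<in>finite_subpshs X. (a, x) \<in> E"
      by (rule rev_bexI)
  qed
qed

lemma locally_finitely_presentable_C:
  assumes fin: "\<And>a. a \<in> A \<Longrightarrow> finite {b. (b, a) \<in> r}"
  shows "locally_finitely_presentable U C"
proof -
  obtain K where K: "K \<in> U" "infinite K"
    using univ by (auto simp: universe_def)
  obtain \<nu> :: "nat \<Rightarrow> 'u" where \<nu>: "inj \<nu>" "range \<nu> \<subseteq> K"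
    using K(2) infinite_countable_subset by blast
  \<comment> \<open>This set of names suffices for every finite subpresheaf, and lies in
    \<open>U\<close> as a subset of a member.\<close>
  define N where "N = range \<nu>"
  have N: "N \<in> U"
    unfolding N_def
    using small_in_universe[OF univ small_subset[OF \<nu>(2) universe_small[OF K(1)]]] .
  let ?S = "{F \<in> Obj C. finite (el F) \<and> snd ` el F \<subseteq> N}"
  have "\<exists>(I :: 'u set) le D c. I \<in> U \<and> directed_poset I le \<and> is_functor (poset_cat I le) C D \<and>
      (\<forall>i\<in>I. Fo D i \<in> ?S) \<and> is_colimit (poset_cat I le) C D X c" if X: "X \<in> Obj C" for X
  proof -
    obtain I :: "'u set" and le E where I: "I \<in> U" "directed_poset I le"
      "E ` I = finite_subpshs X" "\<And>i j. (i, j) \<in> le \<Longrightarrow> E i \<subseteq> E j"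
      using directed_encoding[OF univ small_finite_subpshs[OF X] finite_subpshs_nonempty
          finite_subpshs_directed] by metis
    have E: "subpsh X (E i)" "finite (E i)" if "i \<in> I" for i
      using I(3) that by (auto simp: finite_subpshs_def)
    have un: "(\<Union>i\<in>I. E i) = el X"
      using I(3) finite_subpshs_Union[OF fin X] by simp
    \<comment> \<open>The finitely many values occurring in \<open>E i\<close> are numbered, and the
      numbers are named by \<open>\<nu>\<close>.\<close>
    have "\<exists>\<phi> :: 'u \<Rightarrow> 'u. inj_on \<phi> (snd ` E i) \<and> range \<phi> \<subseteq> N" if i: "i \<in> I" for i
    proof -
      obtain f :: "'u \<Rightarrow> nat" where "inj_on f (snd ` E i)"
        using finite_imp_inj_to_nat_seg[OF finite_imageI[OF E(2)[OF i]]] by metis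
      then have "inj_on (\<nu> \<circ> f) (snd ` E i)"
        using \<nu>(1) by (meson comp_inj_on inj_on_subset subset_UNIV)
      then show ?thesis
        by (intro exI[of _ "\<nu> \<circ> f"]) (auto simp: N_def)
    qed
    then obtain \<phi> :: "'u \<Rightarrow> 'u \<Rightarrow> 'u" where \<phi>: "\<And>i. i \<in> I \<Longrightarrow> inj_on (\<phi> i) (snd ` E i)"
      "\<And>i. i \<in> I \<Longrightarrow> range (\<phi> i) \<subseteq> N"
      by metis
    let ?D = "union_diagram X I le E \<phi>"
    have "Fo ?D i \<in> ?S" if i: "i \<in> I" for i
    proof -
      have Di: "Fo ?D i = copy_psh X (E i) (\<phi> i)"
        using i by (simp add: union_diagram_def)
      have "el (copy_psh X (E i) (\<phi> i)) \<subseteq> (\<lambda>(a, x). (a, \<phi> i x)) ` E i"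
        by (force simp: el_def Fo_copy_psh)
      moreover have "\<phi> i x \<in> N" for x
        using \<phi>(2)[OF i] by blast
      then have "snd ` el (copy_psh X (E i) (\<phi> i)) \<subseteq> N"
        by (auto simp: el_def Fo_copy_psh)
      ultimately show ?thesis
        using copy_psh_Obj[OF X E(1)[OF i] \<phi>(1)[OF i]] E(2)[OF i] Di
        by (simp add: finite_subset)
    qed
    moreover note union_diagram_functor[OF X I(2) E(1) \<phi>(1) I(4) un]
      union_is_colimit[OF X I(2) E(1) \<phi>(1) I(4) un]
    ultimately show ?thesis
      using I(1,2) by blast
  qed
  moreover have "\<forall>F\<in>?S. finitely_presentable U C F"
    using finite_psh_finitely_presentable by blast
  ultimately show ?thesis
    unfolding locally_finitely_presentable_def
    using category_C cocomplete_C small_finite_presheaves[OF N] by blast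
qed

section \<open>Finitely presentable presheaves are finite, and counting elements gives a
  grade\<close>

lemma finitely_presentable_finite:
  assumes fin: "\<And>a. a \<in> A \<Longrightarrow> finite {b. (b, a) \<in> r}" and X: "finitely_presentable U C X"
  shows "finite (el X)"
proof -
  have XO: "X \<in> Obj C"
    using X by (simp add: finitely_presentable_def)
  have "el X \<in> finite_subpshs X"
    by (rule finitely_presentable_in_directed_union[OF X small_finite_subpshs[OF XO]
          finite_subpshs_nonempty finite_subpshs_directed _ finite_subpshs_Union[OF fin XO]])
      (auto simp: finite_subpshs_def)
  then show ?thesis
    by (simp add: finite_subpshs_def)
qed

text \<open>Bundling all components into one map between sets of elements reduces the comparison of
  grades to counting along injections and surjections of finite sets.\<close>

definition el_map :: "('a, 'u) psh_arr \<Rightarrow> 'a \<times> 'u \<Rightarrow> 'a \<times> 'u" where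
  "el_map m = (\<lambda>(a, x). (a, app m a x))"

lemma el_map_in: "m \<in> hom C F G \<Longrightarrow> el_map m ` el F \<subseteq> el G"
  using app_in[of m F G] by (auto simp: el_map_def el_iff)

lemma inj_el_map_iff: "inj_on (el_map m) (el F) \<longleftrightarrow> (\<forall>a\<in>A. inj_on (app m a) (Fo F a))"
  by (auto simp: inj_on_def el_map_def el_def)

lemma surj_el_map_iff:
  "el_map m ` el F = el G \<longleftrightarrow> (\<forall>a\<in>A. app m a ` Fo F a = Fo G a)"
proof -
  have "el_map m ` el F = Sigma A (\<lambda>a. app m a ` Fo F a)"
    by (auto simp: el_map_def el_def image_iff)
  moreover have "Sigma A f = Sigma A g \<longleftrightarrow> (\<forall>a\<in>A. f a = g a)" for f g :: "'a \<Rightarrow> 'u set"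
    unfolding set_eq_iff split_paired_All mem_Sigma_iff by blast
  ultimately show ?thesis
    by (simp add: el_def)
qed

lemma iso_arr_if_el_map:
  assumes "m \<in> hom C F G" "inj_on (el_map m) (el F)" "el_map m ` el F = el G"
  shows "iso_arr C m"
  using assms surj_el_map_iff[of m F G]
  by (intro iso_arr_if_bij[OF assms(1)]) (simp add: bij_betw_def inj_el_map_iff)

lemma graduated_C:
  assumes fin: "\<And>a. a \<in> A \<Longrightarrow> finite {b. (b, a) \<in> r}"
  shows "graduated_category U C"
  unfolding graduated_category_def
proof (intro conjI locally_finitely_presentable_C[OF fin] exI[of _ "\<lambda>X. card (el X)"] allI impI ballI)
  fix X assume X: "finitely_presentable U C X"
  note finX = finitely_presentable_finite[OF fin X]
  {
    fix m assume "m \<in> subobjects C X"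
    then have m: "m \<in> hom C (Dom C m) X" and mono: "mono_arr C m"
      using arr_hom[of m C] by (auto simp: subobjects_def mono_arr_def)
    have inj: "inj_on (el_map m) (el (Dom C m))"
      using inj_if_mono_arr[OF m mono] by (simp add: inj_el_map_iff)
    note sub = el_map_in[OF m]
    have fin: "finite (el (Dom C m))"
      using inj sub finX by (metis finite_imageD finite_subset)
    show "finitely_presentable U C (Dom C m)"
      using finite_psh_finitely_presentable[OF hom_dom[OF m] fin] .
    show le: "card (el (Dom C m)) \<le> card (el X)"
      using card_inj_on_le[OF inj sub finX] .
    assume niso: "\<not> iso_arr C m"
    \<comment> \<open>An injective arrow that hits every element is invertible, so a proper
      subobject misses one.\<close>
    have "el_map m ` el (Dom C m) \<noteq> el X"
      using iso_arr_if_el_map[OF m inj] niso by blast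
    then have "card (el_map m ` el (Dom C m)) < card (el X)"
      using sub finX by (metis psubset_card_mono psubsetI)
    then show "card (el (Dom C m)) < card (el X)"
      using card_image[OF inj] by simp
  }
  {
    fix e assume "e \<in> strong_quotients C X"
    then have e: "e \<in> hom C X (Cod C e)" and strong: "strong_epi_arr C e"
      using arr_hom[of e C] by (auto simp: strong_quotients_def strong_epi_arr_def epi_arr_def)
    have surj: "el_map e ` el X = el (Cod C e)"
      using surj_if_strong_epi_arr[OF e strong] by (simp add: surj_el_map_iff)
    have fin: "finite (el (Cod C e))"
      using surj finX by (metis finite_imageI)
    show "finitely_presentable U C (Cod C e)"
      using finite_psh_finitely_presentable[OF hom_cod[OF e] fin] .
    show le: "card (el (Cod C e)) \<le> card (el X)"
      using card_image_le[OF finX, of "el_map e"] surj by simp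
    assume niso: "\<not> iso_arr C e"
    \<comment> \<open>A surjection between finite sets of equal size is injective, which would make
      \<open>e\<close> an isomorphism.\<close>
    have "card (el (Cod C e)) \<noteq> card (el X)"
      using iso_arr_if_el_map[OF e _ surj] niso eq_card_imp_inj_on[OF finX, of "el_map e"] surj
      by auto
    then show "card (el (Cod C e)) < card (el X)"
      using le by simp
  }
qed

section \<open>Down-sets under the descending chain condition\<close>

lemma el_downset_psh: "E \<subseteq> A \<Longrightarrow> el (downset_psh E) = E \<times> {undefined}"
  using Fo_downset_psh_iff by (auto simp: el_def)

text \<open>The down-sets generated by finite subsets of \<open>E\<close> form a directed family
  with union \<open>E\<close>, so one of them is all of \<open>E\<close>. A finite union of
  principal down-sets can be infinite only if one of them is.\<close>

lemma finitely_presentable_infinite_downset: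
  assumes E: "downset E" "infinite E" and fp: "finitely_presentable U C (downset_psh E)"
  obtains x where "x \<in> E" "infinite {b. (b, x) \<in> r}"
proof -
  define gen where "gen F = (\<Union>x\<in>F. {b. (b, x) \<in> r}) \<times> {undefined :: 'u}" for F
  have EA: "E \<subseteq> A"
    using E by (simp add: downset_def)
  have gen_sub: "gen F \<subseteq> E \<times> {undefined}" if "F \<subseteq> E" for F
    using that E(1) by (auto simp: gen_def downset_def)
  have "el (downset_psh E) \<in> gen ` Fpow E"
  proof (rule finitely_presentable_in_directed_union[OF fp])
    show "small U (gen ` Fpow E)"
      by (intro small_image small_Fpow univ small_subset[OF EA smallA])
    show "gen ` Fpow E \<noteq> {}"
      by (simp add: Fpow_not_empty)
    show "\<exists>G\<in>gen ` Fpow E. S \<subseteq> G \<and> T \<subseteq> G" if ST: "S \<in> gen ` Fpow E" "T \<in> gen ` Fpow E" for S T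
    proof -
      obtain F G where FG: "F \<in> Fpow E" "G \<in> Fpow E" "S = gen F" "T = gen G"
        using ST by blast
      then have "F \<union> G \<in> Fpow E"
        by (simp add: Fpow_def)
      moreover have "S \<subseteq> gen (F \<union> G)" "T \<subseteq> gen (F \<union> G)"
        using FG by (auto simp: gen_def)
      ultimately show ?thesis
        by blast
    qed
    show "subpsh (downset_psh E) S" if S: "S \<in> gen ` Fpow E" for S
    proof -
      obtain F where F: "F \<subseteq> E" "S = gen F"
        using S unfolding Fpow_def by blast
      note sub = gen_sub[OF F(1)]
      have "(b, res (downset_psh E) b a x) \<in> S" if "(a, x) \<in> S" "(b, a) \<in> r" for a x b
      proof -
        have "x \<in> Fo (downset_psh E) a"
          using sub F(2) that r_in_A by (auto simp: Fo_downset_psh)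
        then show ?thesis
          using that F(2) trans_r by (auto simp: res_downset_psh gen_def)
      qed
      then show ?thesis
        unfolding subpsh_def using sub F(2) by (auto simp: el_downset_psh[OF EA])
    qed
    show "\<Union>(gen ` Fpow E) = el (downset_psh E)"
    proof
      show "\<Union>(gen ` Fpow E) \<subseteq> el (downset_psh E)"
        using gen_sub by (auto simp: el_downset_psh[OF EA] Fpow_def)
      have "(x, undefined) \<in> gen {x} \<and> {x} \<in> Fpow E" if "x \<in> E" for x
        using that EA refl_r by (auto simp: gen_def Fpow_def)
      then show "el (downset_psh E) \<subseteq> \<Union>(gen ` Fpow E)"
        by (auto simp: el_downset_psh[OF EA])
    qed
  qed
  then obtain F where F: "F \<subseteq> E" "finite F" "gen F = E \<times> {undefined}"
    by (auto simp: Fpow_def el_downset_psh[OF EA])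
  have EF: "E = (\<Union>x\<in>F. {b. (b, x) \<in> r})"
    using F(3) by (auto simp: gen_def)
  have "infinite (\<Union>x\<in>F. {b. (b, x) \<in> r})"
    using E(2) by (simp only: EF[symmetric] not_False_eq_True)
  then have "\<exists>x\<in>F. infinite {b. (b, x) \<in> r}"
    by (simp add: F(2))
  then show thesis
    using that F(1) by blast
qed

text \<open>An infinite finitely generated down-set contains an infinite principal down-set, and
  removing the top element of that leaves a strictly smaller infinite down-set.\<close>

lemma DCC_imp_finite_principal:
  assumes DCC: "DCC_category U C" and a: "a \<in> A"
  shows "finite {b. (b, a) \<in> r}"
proof (rule ccontr)
  assume inf: "infinite {b. (b, a) \<in> r}"
  let ?P = "{b. (b, a) \<in> r}"
  have "downset_psh ?P \<in> Obj C"
    using downset_psh_Obj[OF downset_principal[OF a]] .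
  \<comment> \<open>The representable at \<open>a\<close> is written as a directed colimit of
    finitely presentable objects. Its element at \<open>a\<close> then lifts to an element
    \<open>p\<close> of some stage.\<close>
  then obtain S I le D c where S: "\<forall>X\<in>S. finitely_presentable U C X"
    and I: "I \<in> U" "directed_poset I le"
    and D: "is_functor (poset_cat I le) C D" "\<forall>i\<in>I. Fo D i \<in> S"
    and c: "is_colimit (poset_cat I le) C D (downset_psh ?P) c"
    using DCC unfolding DCC_category_def locally_finitely_presentable_def by metis
  have "pointwise_colimit (poset_cat I le) D (downset_psh ?P) c"
    by (rule colimit_is_pointwise[OF directed_poset_category[OF I(2)] D(1) _ c])
      (simp add: universe_small[OF I(1)])
  moreover have "undefined \<in> Fo (downset_psh ?P) a"
    using a refl_r by (simp add: Fo_downset_psh)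
  ultimately obtain i p where i: "i \<in> I" and p: "p \<in> Fo (Fo D i) a"
    using a unfolding pointwise_colimit_def by fastforce
  define F where "F = Fo D i"
  have fpF: "finitely_presentable U C F"
    using S D(2) i by (simp add: F_def)
  then have F: "F \<in> Obj C"
    by (simp add: finitely_presentable_def)
  \<comment> \<open>The arrow that picks \<open>p\<close>, restricted to \<open>E\<close>. It is a
    monomorphism because the fibres of its domain have at most one element.\<close>
  define m where "m E = elt_arr E a F p" for E
  have m: "m E \<in> hom C (downset_psh E) F" if "downset E" "E \<subseteq> ?P" for E
    unfolding m_def using elt_arr_hom[OF F that] p by (simp add: F_def)
  have msub: "m E \<in> subobjects C F" if E: "downset E" "E \<subseteq> ?P" for E
  proof -
    have "mono_arr C (m E)"
      by (rule mono_arr_if_inj[OF m[OF E]]) (auto simp: Fo_downset_psh)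
    then show ?thesis
      using homD[OF m[OF E]] by (simp add: subobjects_def)
  qed
  have smaller: "\<exists>E'. (downset E' \<and> E' \<subseteq> ?P \<and> infinite E') \<and> E' \<subset> E"
    if E: "downset E" "E \<subseteq> ?P" "infinite E" for E
  proof -
    have "finitely_presentable U C (Dom C (m E))"
      using DCC fpF msub[OF E(1,2)] unfolding DCC_category_def by blast
    then have "finitely_presentable U C (downset_psh E)"
      using homD[OF m[OF E(1,2)]] by simp
    then obtain x where x: "x \<in> E" "infinite {b. (b, x) \<in> r}"
      using finitely_presentable_infinite_downset[OF E(1,3)] by blast
    have "x \<in> A"
      using x(1) E(1) by (auto simp: downset_def)
    let ?E = "{b. (b, x) \<in> r} - {x}"
    have "downset ?E"
      unfolding downset_def
    proof (intro conjI ballI allI impI)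
      show "?E \<subseteq> A"
        using r_in_A by blast
      fix y z assume "y \<in> ?E" "(z, y) \<in> r"
      then show "z \<in> ?E"
        using trans_r[of z y x] antisym_r[of y x] by auto
    qed
    moreover have "?E \<subset> E"
      using x(1) E(1) by (auto simp: downset_def)
    moreover have "infinite ?E"
      using x(2) by simp
    ultimately show ?thesis
      using E(2) by blast
  qed
  \<comment> \<open>The choice starts from the principal down-set of \<open>a\<close>. All later
    members lie below \<open>a\<close>, so the same \<open>p\<close> embeds each of them in the same
    \<open>F\<close>.\<close>
  have "\<exists>f :: nat \<Rightarrow> 'a set. \<forall>n. (downset (f n) \<and> f n \<subseteq> ?P \<and> infinite (f n)) \<and> f (Suc n) \<subset> f n"
    by (rule dependent_nat_choice) (use inf downset_principal[OF a] smaller in blast)+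
  then obtain f :: "nat \<Rightarrow> 'a set" where f: "\<And>n. downset (f n)" "\<And>n. f n \<subseteq> ?P"
    "\<And>n. f (Suc n) \<subset> f n"
    by metis
  have fA: "f n \<subseteq> A" for n
    using f(1) by (simp add: downset_def)
  have "sub_le C (m (f (Suc n))) (m (f n))" for n
  proof -
    let ?h = "mkarr (downset_psh (f (Suc n))) (\<lambda>b x. x) (downset_psh (f n))"
    have h: "?h \<in> hom C (downset_psh (f (Suc n))) (downset_psh (f n))"
    proof (rule mkarr_hom[OF downset_psh_Obj[OF f(1)] downset_psh_Obj[OF f(1)]])
      show "x \<in> Fo (downset_psh (f n)) b"
        if "b \<in> A" "x \<in> Fo (downset_psh (f (Suc n))) b" for b x
        using that f(3)[of n] by (auto simp: Fo_downset_psh_iff)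
      then show "res (downset_psh (f (Suc n))) b' b x = res (downset_psh (f n)) b' b x"
        if "(b', b) \<in> r" "x \<in> Fo (downset_psh (f (Suc n))) b" for b b' x
        using that r_in_A by (simp add: res_downset_psh)
    qed
    have "m (f (Suc n)) = Comp C (m (f n)) ?h"
    proof (rule arr_eqI[OF m[OF f(1,2)] comp_hom[OF category_C h m[OF f(1,2)]]])
      fix b x assume b: "b \<in> A" and x: "x \<in> Fo (downset_psh (f (Suc n))) b"
      then have "b \<in> f (Suc n)" "b \<in> f n" "x = undefined"
        using f(3)[of n] by (auto simp: Fo_downset_psh_iff)
      then show "app (m (f (Suc n))) b x = app (Comp C (m (f n)) ?h) b x"
        using app_comp[OF h m[OF f(1,2)] b x] b x by (simp add: m_def app_elt_arr)
    qed
    then show ?thesis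
      unfolding sub_le_def using h homD[OF m[OF f(1,2)]] by metis
  qed
  moreover have "\<not> sub_le C (m (f n)) (m (f (Suc n)))" for n
  proof
    assume "sub_le C (m (f n)) (m (f (Suc n)))"
    then obtain h where h: "h \<in> hom C (downset_psh (f n)) (downset_psh (f (Suc n)))"
      using homD[OF m[OF f(1,2)]] unfolding sub_le_def by metis
    \<comment> \<open>An arrow in the reverse direction would have to send the element at
      \<open>b\<close> into an empty fibre.\<close>
    obtain b where b: "b \<in> f n" "b \<notin> f (Suc n)" "b \<in> A"
      using f(3) fA by blast
    then have "undefined \<in> Fo (downset_psh (f n)) b"
      by (simp add: Fo_downset_psh)
    then show False
      using app_in[OF h b(3)] b by (auto simp: Fo_downset_psh)
  qed
  ultimately have "\<not> descending_chains_finite (sub_le C) (subobjects C F)"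
    unfolding descending_chains_finite_def using msub[OF f(1,2)]
    by (auto intro!: exI[of _ "\<lambda>n. m (f n)"])
  then show False
    using DCC fpF unfolding DCC_category_def by blast
qed

end

theorem theorem6p3:
  fixes A :: "'a set" and r :: "'a rel" and U :: "'u set set"
  assumes "partial_order_on A r"
    and "universe U"
    and "small U A"
  shows "(DCC_category U (presheaf_cat U A r) \<longleftrightarrow> graduated_category U (presheaf_cat U A r)) \<and>
         (graduated_category U (presheaf_cat U A r) \<longleftrightarrow>
            (\<forall>S \<subseteq> A. (\<exists>a \<in> A. \<forall>s \<in> S. (s, a) \<in> r) \<longrightarrow> finite S))"
proof -
  interpret presheaves A r U
    using assms by unfold_locales
  \<comment> \<open>The principal down-set of \<open>a\<close> is the largest set bounded by
    \<open>a\<close>, so finiteness need only be tested there.\<close>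
  have bounded_iff: "(\<forall>S \<subseteq> A. (\<exists>a \<in> A. \<forall>s \<in> S. (s, a) \<in> r) \<longrightarrow> finite S) \<longleftrightarrow>
      (\<forall>a \<in> A. finite {b. (b, a) \<in> r})" (is "?L \<longleftrightarrow> ?R")
  proof
    assume L: ?L
    show ?R
    proof
      fix a assume "a \<in> A"
      moreover have "{b. (b, a) \<in> r} \<subseteq> A"
        using r_in_A by blast
      ultimately show "finite {b. (b, a) \<in> r}"
        using L by blast
    qed
  next
    assume R: ?R
    show ?L
    proof (intro allI impI)
      fix S assume "\<exists>a \<in> A. \<forall>s \<in> S. (s, a) \<in> r"
      then obtain a where "a \<in> A" "S \<subseteq> {b. (b, a) \<in> r}"
        by blast
      then show "finite S"
        using R finite_subset by blast
    qed
  qed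
  \<comment> \<open>Three implications close the cycle: graduated gives DCC, DCC gives finite
    principal down-sets, and these give graduated.\<close>
  show ?thesis
    unfolding bounded_iff
    using graduated_imp_DCC DCC_imp_finite_principal graduated_C by blast
qed

end
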